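(* The equation $7x^3+2y^3=3z^2+1$ has no integer solutions; that is, there is no triple $(x,y,z)\in\mathbb{Z}^3$ with $7x^3+2y^3=3z^2+1$. *)

theory Defs
  imports Main
begin

end

theory Submission
  imports Defs "HOL-Number_Theory.Number_Theory" "HOL-Computational_Algebra.Polynomial"
begin

text \<open>
  A solution has \<open>z\<close> even and 7 dividing both \<open>y\<close> and \<open>3 z\<^sup>2 + 1\<close>. Put \<open>y = 7 v\<close>; then
  \<open>3 z\<^sup>2 + 1 = 7 (x\<^sup>3 + 98 v\<^sup>3)\<close> is the norm of \<open>\<alpha> = 1 + z \<surd>-3\<close> in the Eisenstein integers. After
  removing the common cube from \<open>x\<^sup>3 + 98 v\<^sup>3\<close> and the powers of 7, a binary cubic form in coprime
  variables remains, and modulo each of its prime factors 28 is a cube. So, if \<open>u\<close> is the part of \<open>\<alpha>\<close>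
  that is prime to 7, the product of the cubic residue symbols of 28 over the prime factors of \<open>u\<close>,
  counted with multiplicity, is 1.

  Cubic reciprocity computes this product in a second way, from \<open>u\<close> modulo 2 and modulo 7 alone.
  The form of it that is needed is the following. Every prime that divides the norm of \<open>u\<close> is split,
  and a prime of norm \<open>p\<close> is generated by the Jacobi sum \<open>J\<close> of its cubic residue symbol \<open>\<psi>\<close>
  (\<open>eval_jacobi\<close>, \<open>norm_jacobi\<close>). Let \<open>G\<close> be the generating polynomial \<open>\<Sum>t. \<psi> t X\<^sup>t\<close> modulo
  \<open>X\<^sup>p - 1\<close>. It satisfies \<open>G\<^sup>2 = J G2\<close>, where \<open>G2\<close> belongs to the conjugate character, and
  \<open>G\<^sup>7 = J\<^sup>2 p\<^sup>2 G\<close>. By the Frobenius congruences modulo 2 and modulo 7, therefore, \<open>J\<close> is \<open>\<psi> 2\<close> modulo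
  2, and \<open>J\<^sup>2 p\<^sup>2\<close>, which is \<open>J\<^sup>4\<close> times the squared conjugate of \<open>J\<close>, is the inverse of \<open>\<psi> 7\<close> modulo 7
  (\<open>jacobi_mod_2\<close>, \<open>jacobi_mod_7\<close>). Both statements are multiplicative, so they carry over to \<open>u\<close>
  (\<open>coherent_of_norm\<close>).

  For the \<open>u\<close> at hand, which is 1 modulo 2, the conclusion is that \<open>u\<^sup>4\<close> times the squared conjugate
  of \<open>u\<close> is 1 modulo 7. But at the prime above 7 that does not divide \<open>\<alpha>\<close> the residue of \<open>u\<close> is known,
  because \<open>\<alpha>\<close> is congruent to 2 there, and the value is not 1 (\<open>no_norm_factorization\<close>).
\<close>

section \<open>The Eisenstein integers\<close>

text \<open>\<^term>\<open>Eis a b\<close> is \<open>a + b\<omega>\<close> with \<open>\<omega>\<^sup>2 + \<omega> + 1 = 0\<close>. Pairs of integers, rather than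
  a subset of the complex numbers, make the divisibility relation of the type the right one.\<close>

datatype eis = Eis (rat: int) (om: int)

instantiation eis :: comm_ring_1
begin

definition zero_eis :: eis where "0 = Eis 0 0"
definition one_eis :: eis where "1 = Eis 1 0"
definition plus_eis :: "eis \<Rightarrow> eis \<Rightarrow> eis"
  where "u + v = Eis (rat u + rat v) (om u + om v)"
definition minus_eis :: "eis \<Rightarrow> eis \<Rightarrow> eis"
  where "u - v = Eis (rat u - rat v) (om u - om v)"
definition uminus_eis :: "eis \<Rightarrow> eis"
  where "- u = Eis (- rat u) (- om u)"
definition times_eis :: "eis \<Rightarrow> eis \<Rightarrow> eis"
  where "u * v = Eis (rat u * rat v - om u * om v) (rat u * om v + om u * rat v - om u * om v)"

instance
  by standard
    (simp_all add: zero_eis_def one_eis_def plus_eis_def minus_eis_def uminus_eis_def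
      times_eis_def algebra_simps)

end

lemma eis_arith [simp]:
  "Eis a b + Eis c d = Eis (a + c) (b + d)"
  "Eis a b - Eis c d = Eis (a - c) (b - d)"
  "- Eis a b = Eis (- a) (- b)"
  "Eis a b * Eis c d = Eis (a * c - b * d) (a * d + b * c - b * d)"
  by (simp_all add: plus_eis_def minus_eis_def uminus_eis_def times_eis_def)

lemma eis_of_nat: "of_nat n = Eis (int n) 0"
  by (induction n) (simp_all add: zero_eis_def one_eis_def)

lemma eis_of_int: "of_int n = Eis n 0"
  by (cases n rule: int_cases2) (simp_all add: eis_of_nat)

lemma eis_numeral: "numeral n = Eis (numeral n) 0"
  using eis_of_int [of "numeral n"] by simp

definition \<omega> :: eis where "\<omega> = Eis 0 1"

lemma omega_square: "\<omega>\<^sup>2 = Eis (-1) (-1)"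
  by (simp add: \<omega>_def power2_eq_square)

lemma omega_cube: "\<omega> ^ 3 = 1"
  by (simp add: \<omega>_def power3_eq_cube one_eis_def)

definition eis_norm :: "eis \<Rightarrow> int"
  where "eis_norm u = (rat u)\<^sup>2 - rat u * om u + (om u)\<^sup>2"

definition eis_cnj :: "eis \<Rightarrow> eis"
  where "eis_cnj u = Eis (rat u - om u) (- om u)"

lemma cnj_0 [simp]: "eis_cnj 0 = 0" and cnj_1 [simp]: "eis_cnj 1 = 1"
  by (simp_all add: eis_cnj_def zero_eis_def one_eis_def)

lemma cnj_add: "eis_cnj (u + v) = eis_cnj u + eis_cnj v"
  by (cases u; cases v) (simp add: eis_cnj_def)

lemma cnj_mult: "eis_cnj (u * v) = eis_cnj u * eis_cnj v"
  by (cases u; cases v) (simp add: eis_cnj_def algebra_simps)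

lemma cnj_power: "eis_cnj (u ^ n) = eis_cnj u ^ n"
  by (induction n) (simp_all add: cnj_mult)

lemma cnj_sum: "eis_cnj (sum f A) = (\<Sum>x\<in>A. eis_cnj (f x))"
  by (induction A rule: infinite_finite_induct) (simp_all add: cnj_add)

lemma mult_cnj: "u * eis_cnj u = of_int (eis_norm u)"
  by (cases u) (simp add: eis_cnj_def eis_norm_def eis_of_int power2_eq_square algebra_simps)

lemma norm_mult: "eis_norm (u * v) = eis_norm u * eis_norm v"
  by (cases u; cases v) (simp add: eis_norm_def power2_eq_square algebra_simps)

lemma norm_power: "eis_norm (u ^ n) = eis_norm u ^ n"
  by (induction n) (simp_all add: norm_mult, simp add: eis_norm_def one_eis_def)

lemma four_norm: "4 * eis_norm u = (2 * rat u - om u)\<^sup>2 + 3 * (om u)\<^sup>2"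
  by (simp add: eis_norm_def power2_eq_square algebra_simps)

lemma norm_eq_0_iff [simp]: "eis_norm u = 0 \<longleftrightarrow> u = 0"
proof
  assume "eis_norm u = 0"
  then have *: "(2 * rat u - om u)\<^sup>2 + 3 * (om u)\<^sup>2 = 0"
    using four_norm [of u] by simp
  moreover have "(2 * rat u - om u)\<^sup>2 \<ge> 0" "(om u)\<^sup>2 \<ge> 0"
    by simp_all
  ultimately have "(om u)\<^sup>2 = 0" "(2 * rat u - om u)\<^sup>2 = 0"
    by linarith+
  then show "u = 0"
    by (cases u) (simp add: zero_eis_def)
qed (simp add: eis_norm_def zero_eis_def)

instance eis :: idom
proof
  fix u v :: eis
  assume "u \<noteq> 0" "v \<noteq> 0"
  then have "eis_norm (u * v) \<noteq> 0"
    by (simp add: norm_mult)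
  then show "u * v \<noteq> 0"
    by auto
qed

lemma of_int_eq_0_eis_iff [simp]: "(of_int n :: eis) = 0 \<longleftrightarrow> n = 0"
  by (simp add: eis_of_int zero_eis_def)

lemma of_int_dvd_iff_eis: "of_int n dvd u \<longleftrightarrow> n dvd rat u \<and> n dvd om u"
proof
  assume "of_int n dvd u"
  then obtain v where "u = of_int n * v" ..
  then show "n dvd rat u \<and> n dvd om u"
    by (cases v) (simp add: eis_of_int)
next
  assume "n dvd rat u \<and> n dvd om u"
  then obtain a b where "rat u = n * a" "om u = n * b"
    by (auto elim!: dvdE)
  then have "u = of_int n * Eis a b"
    by (cases u) (simp add: eis_of_int)
  then show "of_int n dvd u" ..
qed

lemma norm_1_cases:
  assumes "eis_norm u = 1"
  obtains k s where "u = s * \<omega> ^ k" "s = 1 \<or> s = -1"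
proof -
  obtain a b where u: "u = Eis a b" by (cases u)
  have *: "(2 * a - b)\<^sup>2 + 3 * b\<^sup>2 = 4"
    using four_norm [of u] assms u by simp
  have "b\<^sup>2 \<le> 1"
    using * zero_le_power2 [of "2 * a - b"] by linarith
  then have b: "b = -1 \<or> b = 0 \<or> b = 1"
    unfolding abs_square_le_1 by arith
  have "(2 * b - a)\<^sup>2 + 3 * a\<^sup>2 = 4"
    using * by (simp add: power2_eq_square algebra_simps)
  then have "a\<^sup>2 \<le> 1"
    using zero_le_power2 [of "2 * b - a"] by linarith
  then have a: "a = -1 \<or> a = 0 \<or> a = 1"
    unfolding abs_square_le_1 by arith
  have "u = 1 * \<omega> ^ 0 \<or> u = -1 * \<omega> ^ 0 \<or> u = 1 * \<omega> ^ 1 \<or> u = -1 * \<omega> ^ 1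
    \<or> u = 1 * \<omega> ^ 2 \<or> u = -1 * \<omega> ^ 2"
    using a b * by (auto simp: u omega_square one_eis_def) (simp_all add: \<omega>_def)
  then show thesis
    using that by metis
qed

text \<open>If \<open>w\<^sup>2 + w + 1\<close> vanishes modulo \<open>p\<close>, substituting \<open>w\<close> for \<open>\<omega>\<close> is a ring homomorphism
  onto the integers modulo \<open>p\<close>. For a split prime \<open>p\<close> its kernel is one of the two prime ideals
  above \<open>p\<close>, so that congruences modulo that ideal become congruences between integers.\<close>

definition eis_eval :: "int \<Rightarrow> eis \<Rightarrow> int"
  where "eis_eval w u = rat u + om u * w"

lemma eval_0 [simp]: "eis_eval w 0 = 0" and eval_1 [simp]: "eis_eval w 1 = 1"
  by (simp_all add: eis_eval_def zero_eis_def one_eis_def)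

lemma eval_diff: "eis_eval w (u - v) = eis_eval w u - eis_eval w v"
  by (cases u; cases v) (simp add: eis_eval_def algebra_simps)

lemma eval_add: "eis_eval w (u + v) = eis_eval w u + eis_eval w v"
  by (cases u; cases v) (simp add: eis_eval_def algebra_simps)

lemma eval_sum: "eis_eval w (sum f A) = (\<Sum>x\<in>A. eis_eval w (f x))"
  by (induction A rule: infinite_finite_induct) (simp_all add: eval_add)

lemma eval_of_int [simp]: "eis_eval w (of_int n) = n"
  by (simp add: eis_eval_def eis_of_int)

lemma of_int_dvd_eval: "of_int n dvd u \<Longrightarrow> n dvd eis_eval w u"
  by (simp add: of_int_dvd_iff_eis eis_eval_def)

lemma eval_mult:
  assumes "[w\<^sup>2 + w + 1 = 0] (mod n)"
  shows "[eis_eval w (u * v) = eis_eval w u * eis_eval w v] (mod n)"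
proof -
  obtain k where k: "w\<^sup>2 + w + 1 = n * k"
    using assms by (auto simp: cong_0_iff)
  have "eis_eval w u * eis_eval w v - eis_eval w (u * v) = om u * om v * (w\<^sup>2 + w + 1)"
    by (cases u; cases v) (simp add: eis_eval_def power2_eq_square algebra_simps)
  then have "eis_eval w u * eis_eval w v - eis_eval w (u * v) = n * (om u * om v * k)"
    unfolding k by simp
  then have "n dvd eis_eval w u * eis_eval w v - eis_eval w (u * v)"
    by simp
  then show ?thesis
    by (simp add: cong_iff_dvd_diff dvd_diff_commute)
qed

lemma eval_power:
  assumes "[w\<^sup>2 + w + 1 = 0] (mod n)"
  shows "[eis_eval w (u ^ k) = eis_eval w u ^ k] (mod n)"
proof (induction k)
  case (Suc k)
  then show ?case
    using cong_trans [OF eval_mult [OF assms, of u "u ^ k"] cong_scalar_left] by simp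
qed simp

lemma eval_eq_cnj_eval:
  assumes "[w\<^sup>2 + w + 1 = 0] (mod n)"
  shows "[eis_norm u = eis_eval w u * eis_eval w (eis_cnj u)] (mod n)"
  using eval_mult [OF assms, of u "eis_cnj u"] by (simp add: mult_cnj)

section \<open>Dividing by elements of prime norm\<close>

text \<open>The elements with evaluation divisible by \<open>p\<close> form the ideal generated by \<open>p\<close> and \<open>\<omega> - w\<close>.
  The conjugate of \<open>J\<close> times either generator is divisible by \<open>p\<close>, that is, by \<open>J\<close> times its
  conjugate; cancelling the conjugate shows that \<open>J\<close> divides the whole ideal.\<close>

lemma dvd_of_eval_zero:
  assumes p: "prime (p :: int)" and w: "[w\<^sup>2 + w + 1 = 0] (mod p)"
    and J: "eis_norm J = p" "[eis_eval w J = 0] (mod p)" and u: "[eis_eval w u = 0] (mod p)"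
  shows "J dvd u"
proof -
  obtain j k where Je: "J = Eis j k" by (cases J)
  obtain a b where ue: "u = Eis a b" by (cases u)
  obtain s where "j + k * w = p * s"
    using J(2) by (auto simp: Je eis_eval_def cong_0_iff)
  then have s: "j = p * s - k * w" by simp
  obtain t where "a + b * w = p * t"
    using u by (auto simp: ue eis_eval_def cong_0_iff)
  then have t: "a = p * t - b * w" by simp
  obtain r where "w\<^sup>2 + w + 1 = p * r"
    using w by (auto simp: cong_0_iff)
  then have r: "w * w = p * r - w - 1" by (simp add: power2_eq_square)
  have "of_int p dvd u * eis_cnj J"
  proof -
    have 1: "rat (u * eis_cnj J) = a * (j - k) + b * k"
      and 2: "om (u * eis_cnj J) = b * j - a * k"
      by (simp_all add: ue Je eis_cnj_def algebra_simps)
    have om: "p dvd b * j - a * k"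
    proof -
      have "b * j - a * k = p * (b * s - t * k)"
        by (simp add: s t algebra_simps)
      then show ?thesis by simp
    qed
    have "a * (j - k) + b * k = (p * t - b * w) * (p * s - k * w - k) + b * k"
      by (simp add: s t)
    also have "\<dots> = p * (t * (p * s - k * w - k) - b * w * s) + b * k * (w * w + w + 1)"
      by (simp add: algebra_simps)
    also have "\<dots> = p * (t * (p * s - k * w - k) - b * w * s + b * k * r)"
      by (simp add: r algebra_simps)
    finally have "p dvd a * (j - k) + b * k" by simp
    with om show ?thesis
      by (simp add: of_int_dvd_iff_eis 1 2)
  qed
  then obtain v where v: "u * eis_cnj J = of_int p * v" ..
  have "of_int p * u = (u * eis_cnj J) * J"
    using mult_cnj [of J] J(1) by (simp add: algebra_simps)
  also have "\<dots> = of_int p * (v * J)"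
    by (simp add: v algebra_simps)
  finally have "u = v * J"
    using p by (auto simp: not_prime_0)
  then show ?thesis by simp
qed

definition primitive :: "eis \<Rightarrow> bool"
  where "primitive u \<longleftrightarrow> coprime (rat u) (om u)"

lemma primitive_not_dvd:
  assumes "primitive u" "prime p"
  shows "\<not> of_int p dvd u"
  using assms by (auto simp: primitive_def of_int_dvd_iff_eis coprime_common_divisor not_prime_unit
      dest: coprime_common_divisor)

lemma primitive_mult_right:
  assumes "primitive (u * v)"
  shows "primitive v"
proof -
  define g where "g = gcd (rat v) (om v)"
  have "of_int g dvd v"
    by (simp add: of_int_dvd_iff_eis g_def)
  then have "of_int g dvd u * v" by simp
  then have "g dvd 1"
    using assms unfolding of_int_dvd_iff_eis primitive_def by (meson coprime_common_divisor)
  then show ?thesis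
    by (simp add: primitive_def g_def coprime_iff_gcd_eq_1)
qed

text \<open>A primitive element is not divisible by \<open>p\<close>, the product of \<open>J\<close> and its conjugate, so the
  whole \<open>p\<close>-part of its norm comes from factors \<open>J\<close>.\<close>

lemma primitive_eval_zero_power_dvd:
  assumes p: "prime (p :: int)" and w: "[w\<^sup>2 + w + 1 = 0] (mod p)"
    and J: "eis_norm J = p" "[eis_eval w J = 0] (mod p)"
    and u: "primitive u" "[eis_eval w u = 0] (mod p)" "p ^ n dvd eis_norm u"
  shows "J ^ n dvd u"
  using u(3)
proof (induction n)
  case (Suc n)
  then have "J ^ n dvd u"
    by (metis dvd_trans le_imp_power_dvd le_SucI order_refl)
  then obtain v where v: "u = J ^ n * v" ..
  show ?case
  proof (cases n)
    case 0
    then show ?thesis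
      using dvd_of_eval_zero [OF p w J u(2)] by simp
  next
    case (Suc k)
    have "p ^ Suc n dvd p ^ n * eis_norm v"
      using \<open>p ^ Suc n dvd _\<close> by (simp add: v norm_mult norm_power J)
    then have "p dvd eis_norm v"
      using p by (auto simp: not_prime_0)
    then have "[eis_eval w v * eis_eval w (eis_cnj v) = 0] (mod p)"
      using cong_dvd_iff [OF eval_eq_cnj_eval [OF w, of v]] by (simp add: cong_0_iff)
    then have "p dvd eis_eval w v \<or> p dvd eis_eval w (eis_cnj v)"
      using p by (simp add: cong_0_iff prime_dvd_mult_iff)
    then show ?thesis
    proof
      assume "p dvd eis_eval w v"
      then have "J dvd v"
        by (intro dvd_of_eval_zero [OF p w J]) (simp add: cong_0_iff)
      then show ?thesis
        by (simp add: v mult.commute mult_dvd_mono)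
    next
      \<comment> \<open>Otherwise the conjugate of \<open>J\<close> divides \<open>v\<close>, so that \<open>p\<close> divides \<open>u\<close>.\<close>
      assume "p dvd eis_eval w (eis_cnj v)"
      then have "J dvd eis_cnj v"
        by (intro dvd_of_eval_zero [OF p w J]) (simp add: cong_0_iff)
      then obtain t where "eis_cnj v = J * t" ..
      then have "v = eis_cnj J * eis_cnj t"
        by (metis cnj_mult eis_cnj_def eis.collapse eis.sel add.inverse_inverse diff_minus_eq_add diff_add_cancel)
      then have "u = of_int p * (J ^ k * eis_cnj t)"
        using mult_cnj [of J] J(1) by (simp add: v Suc algebra_simps)
      then show ?thesis
        using primitive_not_dvd [OF u(1) p] by simp
    qed
  qed
qed simp

text \<open>If \<open>p\<close> divides the norm of a primitive \<open>a + b\<omega>\<close>, then \<open>b\<close> is invertible modulo \<open>p\<close> and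
  \<open>- a / b\<close> is a root of \<open>w\<^sup>2 + w + 1\<close> there.\<close>

lemma primitive_prime_root:
  assumes p: "prime p" and u: "primitive u" "p dvd eis_norm u"
  obtains w where "[w\<^sup>2 + w + 1 = 0] (mod p)" "[eis_eval w u = 0] (mod p)"
proof -
  obtain a b where ue: "u = Eis a b" by (cases u)
  have N: "p dvd a\<^sup>2 - a * b + b\<^sup>2"
    using u by (simp add: ue eis_norm_def)
  have "\<not> p dvd b"
  proof
    assume b: "p dvd b"
    have "a\<^sup>2 = (a\<^sup>2 - a * b + b\<^sup>2) + b * (a - b)"
      by (simp add: power2_eq_square algebra_simps)
    then have "p dvd a\<^sup>2"
      using N b by (metis dvd_add dvd_mult2)
    then have "p dvd a"
      using p prime_dvd_power by blast
    with b show False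
      using primitive_not_dvd [OF u(1) p] by (simp add: ue of_int_dvd_iff_eis)
  qed
  then have cop: "coprime b p"
    using p by (metis prime_imp_coprime coprime_commute)
  then obtain c where c: "[b * c = 1] (mod p)"
    using cong_solve_coprime_int by blast
  define w where "w = - a * c"
  have bw: "[b * w = - a] (mod p)"
    using cong_scalar_left [OF c, of "-a"] by (simp add: w_def algebra_simps)
  have "b\<^sup>2 * (w\<^sup>2 + w + 1) = (b * w)\<^sup>2 + b * (b * w) + b\<^sup>2"
    by (simp add: power2_eq_square algebra_simps)
  also have "[\<dots> = (- a)\<^sup>2 + b * (- a) + b\<^sup>2] (mod p)"
    by (intro cong_add cong_pow cong_mult cong_refl bw)
  also have "(- a)\<^sup>2 + b * (- a) + b\<^sup>2 = a\<^sup>2 - a * b + b\<^sup>2"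
    by simp
  also have "[\<dots> = 0] (mod p)"
    using N by (simp add: cong_0_iff)
  finally have "p dvd w\<^sup>2 + w + 1"
    using p \<open>\<not> p dvd b\<close> by (auto simp: cong_0_iff prime_dvd_mult_iff dest: prime_dvd_power)
  moreover have "[eis_eval w u = 0] (mod p)"
    using bw by (simp add: ue eis_eval_def cong_iff_dvd_diff mult.commute add.commute)
  ultimately show thesis
    using that by (simp add: cong_0_iff)
qed

section \<open>Group-ring arithmetic modulo \<open>X\<^sup>p - 1\<close>\<close>

lemma prime_dvd_power_add:
  fixes a b :: "'a :: comm_ring_1"
  assumes "prime q"
  shows "of_nat q dvd (a + b) ^ q - (a ^ q + b ^ q)"
proof -
  have q: "q > 0" using assms by (simp add: prime_gt_0_nat)
  have "(a + b) ^ q = (\<Sum>k\<in>{..q}. of_nat (q choose k) * a ^ k * b ^ (q - k))"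
    by (rule binomial_ring)
  also have "{..q} = insert 0 (insert q {0<..<q})"
    using q by auto
  also have "(\<Sum>k\<in>\<dots>. of_nat (q choose k) * a ^ k * b ^ (q - k))
      = (a ^ q + b ^ q) + (\<Sum>k\<in>{0<..<q}. of_nat (q choose k) * a ^ k * b ^ (q - k))"
    using q by simp
  finally have "(a + b) ^ q - (a ^ q + b ^ q)
      = (\<Sum>k\<in>{0<..<q}. of_nat (q choose k) * a ^ k * b ^ (q - k))"
    by simp
  also have "of_nat q dvd \<dots>"
  proof (rule dvd_sum)
    fix k assume "k \<in> {0<..<q}"
    then have "q dvd q choose k"
      using assms by (intro dvd_choose_prime) auto
    then have "(of_nat q :: 'a) dvd of_nat (q choose k)"
      by (metis dvd_def of_nat_mult)
    then show "of_nat q dvd of_nat (q choose k) * a ^ k * b ^ (q - k)"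
      by (simp add: mult.assoc)
  qed
  finally show ?thesis .
qed

lemma prime_dvd_power_sum:
  fixes f :: "'b \<Rightarrow> 'a :: comm_ring_1"
  assumes "prime q" "finite A"
  shows "of_nat q dvd (sum f A) ^ q - (\<Sum>x\<in>A. f x ^ q)"
  using assms(2)
proof (induction A rule: finite_induct)
  case empty
  then show ?case using prime_gt_0_nat [OF assms(1)] by (simp add: zero_power)
next
  case (insert x A)
  have "(f x + sum f A) ^ q - (f x ^ q + (\<Sum>x\<in>A. f x ^ q)) =
    ((f x + sum f A) ^ q - (f x ^ q + sum f A ^ q)) + (sum f A ^ q - (\<Sum>x\<in>A. f x ^ q))"
    by simp
  also have "of_nat q dvd \<dots>"
    by (intro dvd_add prime_dvd_power_add assms(1) insert.IH)
  finally show ?case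
    using insert.hyps by simp
qed

lemma prime_not_dvd_prime:
  "prime p \<Longrightarrow> prime q \<Longrightarrow> p \<noteq> q \<Longrightarrow> \<not> int p dvd int q"
  using primes_dvd_imp_eq by auto

lemma sum_residues_affine:
  assumes p: "p > 0" "coprime c (int p)"
    and F: "\<And>s t. [s = t] (mod int p) \<Longrightarrow> F s = F t"
  shows "(\<Sum>n<p. F (c * int n + d)) = (\<Sum>n<p. F (int n))"
proof -
  let ?h = "\<lambda>n. nat ((c * int n + d) mod int p)"
  have inj: "inj_on ?h {..<p}"
  proof (rule inj_onI)
    fix m n assume mn: "m \<in> {..<p}" "n \<in> {..<p}" "?h m = ?h n"
    then have "[c * int m + d = c * int n + d] (mod int p)"
      using p by (simp add: cong_def eq_nat_nat_iff)
    then have "[int m = int n] (mod int p)"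
      using p cong_add_rcancel cong_mult_lcancel by blast
    then show "m = n"
      using mn by (simp add: cong_def)
  qed
  have "?h ` {..<p} \<subseteq> {..<p}"
    using p by (auto simp: nat_less_iff)
  then have "bij_betw ?h {..<p} {..<p}"
    using inj by (simp add: bij_betw_def endo_inj_surj)
  then have "(\<Sum>n<p. F (int (?h n))) = (\<Sum>n<p. F (int n))"
    by (rule sum.reindex_bij_betw)
  moreover have "F (int (?h n)) = F (c * int n + d)" for n
    by (rule F) (use p in \<open>simp add: cong_def\<close>)
  ultimately show ?thesis by (simp only:)
qed

text \<open>The quotient of the polynomial ring by \<open>X\<^sup>p - 1\<close> is the group ring of the integers modulo \<open>p\<close>.
  It takes the place of the ring generated by a \<open>p\<close>-th root of unity, in which Gauss sums usually
  live: \<open>gauss_poly\<close> below specialises to the Gauss sum, and multiplication becomes convolution.\<close>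

definition cyc_cong :: "nat \<Rightarrow> eis poly \<Rightarrow> eis poly \<Rightarrow> bool"
  where "cyc_cong p f g \<longleftrightarrow> monom 1 p - 1 dvd f - g"

lemma cyc_cong_refl [simp]: "cyc_cong p f f"
  by (simp add: cyc_cong_def)

lemma cyc_cong_sym: "cyc_cong p f g \<Longrightarrow> cyc_cong p g f"
  using dvd_minus_iff [of "monom 1 p - 1" "f - g"] by (simp add: cyc_cong_def)

lemma cyc_cong_trans [trans]:
  assumes "cyc_cong p f g" "cyc_cong p g h"
  shows "cyc_cong p f h"
  using dvd_add [OF assms [unfolded cyc_cong_def]] by (simp add: cyc_cong_def)

lemma cyc_cong_add:
  assumes "cyc_cong p f g" "cyc_cong p h k"
  shows "cyc_cong p (f + h) (g + k)"
  using dvd_add [OF assms [unfolded cyc_cong_def]] by (simp add: cyc_cong_def add_diff_add)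

lemma cyc_cong_diff:
  assumes "cyc_cong p f g" "cyc_cong p h k"
  shows "cyc_cong p (f - h) (g - k)"
proof -
  have "f - h - (g - k) = f - g - (h - k)"
    by simp
  then show ?thesis
    using dvd_diff [OF assms [unfolded cyc_cong_def]] by (simp only: cyc_cong_def)
qed

lemma cyc_cong_mult: 
  assumes "cyc_cong p f g" "cyc_cong p h k"
  shows "cyc_cong p (f * h) (g * k)"
proof -
  have "f * h - g * k = (f - g) * h + g * (h - k)"
    by (simp add: algebra_simps)
  then show ?thesis
    using assms by (simp add: cyc_cong_def)
qed

lemma cyc_cong_smult: "cyc_cong p f g \<Longrightarrow> cyc_cong p (smult c f) (smult c g)"
  by (simp add: cyc_cong_def dvd_smult flip: smult_diff_right)

lemma cyc_cong_power: "cyc_cong p f g \<Longrightarrow> cyc_cong p (f ^ n) (g ^ n)"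
  by (induction n) (simp_all add: cyc_cong_mult)

lemma cyc_cong_sum:
  "(\<And>x. x \<in> A \<Longrightarrow> cyc_cong p (f x) (g x)) \<Longrightarrow> cyc_cong p (sum f A) (sum g A)"
  by (induction A rule: infinite_finite_induct) (auto intro: cyc_cong_add)

lemma cyc_cong_monom: "cyc_cong p (monom c n) (monom c (n mod p))"
proof -
  have "cyc_cong p (monom 1 p ^ (n div p)) (1 ^ (n div p))"
    by (rule cyc_cong_power) (simp add: cyc_cong_def)
  then have "cyc_cong p (monom c (n mod p) * monom 1 p ^ (n div p)) (monom c (n mod p) * 1)"
    by (intro cyc_cong_mult) simp_all
  then show ?thesis
    by (simp add: monom_power mult_monom)
qed

definition gauss_poly :: "nat \<Rightarrow> (int \<Rightarrow> eis) \<Rightarrow> eis poly"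
  where "gauss_poly p f = (\<Sum>n<p. monom (f (int n)) n)"

definition conv :: "nat \<Rightarrow> (int \<Rightarrow> eis) \<Rightarrow> (int \<Rightarrow> eis) \<Rightarrow> int \<Rightarrow> eis"
  where "conv p f g a = (\<Sum>n<p. f (int n) * g (a - int n))"

lemma coeff_gauss_poly: "coeff (gauss_poly p f) n = (if n < p then f (int n) else 0)"
  by (simp add: gauss_poly_def coeff_sum coeff_monom sum.delta)

lemma smult_sum_right: "smult c (sum f A) = (\<Sum>x\<in>A. smult c (f x))"
  by (induction A rule: infinite_finite_induct) (simp_all add: smult_add_right)

lemma gauss_poly_smult: "smult c (gauss_poly p f) = gauss_poly p (\<lambda>t. c * f t)"
  by (rule poly_eqI) (simp add: coeff_gauss_poly)

lemma gauss_poly_diff: "gauss_poly p f - gauss_poly p g = gauss_poly p (\<lambda>t. f t - g t)"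
  by (rule poly_eqI) (simp add: coeff_gauss_poly)

lemma gauss_poly_mult:
  assumes p: "p > 0" and g: "\<And>s t. [s = t] (mod int p) \<Longrightarrow> g s = g t"
  shows "cyc_cong p (gauss_poly p f * gauss_poly p g) (gauss_poly p (conv p f g))"
proof -
  have inner: "(\<Sum>n<p. monom (f m * g (int n)) ((nat ((1 * int n + m) mod int p))))
      = (\<Sum>n<p. monom (f m * g (int n - m)) n)" for m
  proof -
    let ?F = "\<lambda>t. monom (f m * g (t - m)) (nat (t mod int p))"
    have "(\<Sum>n<p. ?F (1 * int n + m)) = (\<Sum>n<p. ?F (int n))"
    proof (rule sum_residues_affine [OF p])
      fix s t :: int assume st: "[s = t] (mod int p)"
      then have "g (s - m) = g (t - m)"
        by (intro g cong_diff) auto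
      with st show "?F s = ?F t"
        by (simp add: cong_def)
    qed simp
    also have "\<dots> = (\<Sum>n<p. monom (f m * g (int n - m)) n)"
      by (intro sum.cong) simp_all
    finally show ?thesis by simp
  qed
  have "gauss_poly p f * gauss_poly p g
      = (\<Sum>m<p. \<Sum>n<p. monom (f (int m) * g (int n)) (m + n))"
    by (simp add: gauss_poly_def sum_product mult_monom)
  also have "cyc_cong p \<dots> (\<Sum>m<p. \<Sum>n<p. monom (f (int m) * g (int n)) ((m + n) mod p))"
    by (intro cyc_cong_sum cyc_cong_monom)
  also have "\<dots> = (\<Sum>m<p. \<Sum>n<p. monom (f (int m) * g (int n)) ((nat ((1 * int n + int m) mod int p))))"
    by (intro sum.cong arg_cong2 [of _ _ _ _ monom] refl)
      (metis add.commute mult_1 nat_int of_nat_add of_nat_mod)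
  also have "\<dots> = (\<Sum>m<p. \<Sum>n<p. monom (f (int m) * g (int n - int m)) n)"
    by (simp only: inner)
  also have "\<dots> = (\<Sum>n<p. \<Sum>m<p. monom (f (int m) * g (int n - int m)) n)"
    by (rule sum.swap)
  also have "\<dots> = gauss_poly p (conv p f g)"
    by (simp add: gauss_poly_def conv_def monom_sum)
  finally show ?thesis .
qed

text \<open>Polynomials of degree below \<open>p\<close> are unique representatives modulo \<open>X\<^sup>p - 1\<close>. Division with
  remainder is available because this modulus is monic, and a factor \<open>c\<close> survives the reduction;
  with \<open>c = 0\<close> this compares coefficients exactly.\<close>

lemma cyc_cong_multiple_coeff:
  assumes p: "p > 0" and c: "cyc_cong p (gauss_poly p f) (smult c Q)" and n: "n < p"
  shows "c dvd f (int n)"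
proof -
  define D :: "eis poly" where "D = monom 1 p - 1"
  have degD: "degree D = p"
  proof (rule antisym)
    show "degree D \<le> p"
      unfolding D_def by (intro degree_diff_le) (simp_all add: degree_monom_le)
    show "p \<le> degree D"
      using p by (intro le_degree) (simp add: D_def coeff_monom)
  qed
  have lead: "coeff D (degree D) = 1"
    using p unfolding degD by (simp add: D_def coeff_monom)
  then have D0: "D \<noteq> 0" by auto
  obtain q r where qr: "pseudo_divmod Q D = (q, r)"
    by fastforce
  have Q: "Q = D * q + r"
    using pseudo_divmod(1) [OF D0 qr] lead by simp
  have r: "r = 0 \<or> degree r < p"
    using pseudo_divmod(2) [OF D0 qr] degD by simp
  let ?h = "gauss_poly p f - smult c r"
  have "D dvd gauss_poly p f - smult c Q"
    using c by (simp add: cyc_cong_def D_def)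
  then have "D dvd (gauss_poly p f - smult c Q) + D * smult c q"
    by (rule dvd_add) (rule dvd_triv_left)
  also have "(gauss_poly p f - smult c Q) + D * smult c q = ?h"
    by (simp add: Q smult_add_right)
  finally have "D dvd ?h" .
  moreover have "degree ?h < p"
  proof (rule degree_lessI)
    show "?h \<noteq> 0 \<or> 0 < p" using p by simp
    show "\<forall>k\<ge>p. coeff ?h k = 0"
      using r by (auto simp: coeff_gauss_poly coeff_eq_0)
  qed
  ultimately have "?h = 0"
    using degD dvd_imp_degree_le [of D ?h] by (cases "?h = 0") auto
  then have "coeff (gauss_poly p f) n = c * coeff r n"
    by simp
  then show ?thesis
    using n by (simp add: coeff_gauss_poly)
qed

section \<open>Jacobi sums of cubic characters\<close>

text \<open>The properties are kept apart from the construction of the cubic residue symbol because they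
  are used for a character and for its square, which is the conjugate character.\<close>

locale cubic_character =
  fixes p :: nat and \<psi> :: "int \<Rightarrow> eis"
  assumes prime: "prime p"
    and cong: "[s = t] (mod int p) \<Longrightarrow> \<psi> s = \<psi> t"
    and mult: "\<psi> (s * t) = \<psi> s * \<psi> t"
    and zero: "\<psi> t = 0 \<longleftrightarrow> int p dvd t"
    and cube: "\<not> int p dvd t \<Longrightarrow> \<psi> t ^ 3 = 1"
    and nontrivial: "\<exists>t. \<not> int p dvd t \<and> \<psi> t \<noteq> 1"
begin

definition jacobi :: eis
  where "jacobi = (\<Sum>n<p. \<psi> (int n) * \<psi> (1 - int n))"

lemma p_pos: "p > 0" and p_gt_1: "p > 1" and prime_int: "prime (int p)"
  using prime prime_gt_0_nat prime_gt_1_nat by auto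

lemma coprime_p: "\<not> int p dvd t \<Longrightarrow> coprime t (int p)"
  using prime_int by (metis coprime_commute prime_imp_coprime)

lemma one: "\<psi> 1 = 1"
proof -
  have "\<psi> 1 \<noteq> 0"
    using zero p_gt_1 by simp
  moreover have "\<psi> 1 * \<psi> 1 = \<psi> 1 * 1"
    using mult [of 1 1] by simp
  ultimately show ?thesis
    by (metis mult_left_cancel)
qed

lemma power: "\<psi> (t ^ n) = \<psi> t ^ n"
  by (induction n) (simp_all add: one mult)

lemma cube_or_zero: "\<psi> t ^ 3 = 1 \<or> \<psi> t = 0"
  using cube zero by blast

lemma power4: "\<psi> t ^ 4 = \<psi> t"
  using cube_or_zero [of t] by (auto simp: eval_nat_numeral)

lemma uminus: "\<psi> (- t) = \<psi> t"
proof -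
  have "\<psi> (- 1) = \<psi> ((- 1) ^ 3)" by simp
  also have "\<dots> = 1"
    unfolding power using p_gt_1 by (intro cube) simp
  finally show ?thesis
    using mult [of "-1" t] by simp
qed

lemma sum_zero: "(\<Sum>n<p. \<psi> (int n)) = 0"
proof -
  obtain c where c: "\<not> int p dvd c" "\<psi> c \<noteq> 1"
    using nontrivial by blast
  have "(\<Sum>n<p. \<psi> (int n)) = (\<Sum>n<p. \<psi> (c * int n + 0))"
    by (rule sum_residues_affine [symmetric, OF p_pos coprime_p [OF c(1)] cong])
  also have "\<dots> = \<psi> c * (\<Sum>n<p. \<psi> (int n))"
    by (simp add: mult sum_distrib_left)
  finally show ?thesis
    using c(2) by (metis mult_cancel_right1)
qed

lemma square_character: "cubic_character p (\<lambda>t. \<psi> t ^ 2)"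
proof
  show "prime p" by (rule prime)
  show "\<psi> s ^ 2 = \<psi> t ^ 2" if "[s = t] (mod int p)" for s t
    using cong [OF that] by simp
  show "\<psi> (s * t) ^ 2 = \<psi> s ^ 2 * \<psi> t ^ 2" for s t
    by (simp add: mult power_mult_distrib)
  show "\<psi> t ^ 2 = 0 \<longleftrightarrow> int p dvd t" for t
    by (simp add: zero)
  show "(\<psi> t ^ 2) ^ 3 = 1" if "\<not> int p dvd t" for t
    using cube [OF that] by (metis power_mult mult.commute power_one)
  obtain t where t: "\<not> int p dvd t" "\<psi> t \<noteq> 1"
    using nontrivial by blast
  then have "\<psi> t ^ 2 \<noteq> 1"
    using cube [OF t(1)] by (auto simp: eval_nat_numeral)
  then show "\<exists>t. \<not> int p dvd t \<and> \<psi> t ^ 2 \<noteq> 1"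
    using t by blast
qed

lemma sum_square_zero: "(\<Sum>n<p. \<psi> (int n) ^ 2) = 0"
  by (rule cubic_character.sum_zero [OF square_character])

text \<open>For \<open>a\<close> prime to \<open>p\<close> the substitution \<open>n \<mapsto> a n\<close> pulls \<open>\<psi> a\<close> out of both factors; for \<open>a\<close>
  divisible by \<open>p\<close> the convolution is the sum of the values of the nontrivial character \<open>\<psi>\<^sup>2\<close>.\<close>

lemma conv_self: "conv p \<psi> \<psi> a = jacobi * \<psi> a ^ 2"
proof (cases "int p dvd a")
  case True
  have "\<psi> (a - t) = \<psi> t" for t
    using cong [of "a - t" "- t"] True uminus [of t] by (simp add: cong_iff_dvd_diff)
  then have "conv p \<psi> \<psi> a = (\<Sum>n<p. \<psi> (int n) ^ 2)"
    by (simp add: conv_def power2_eq_square)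
  then show ?thesis
    using True zero sum_square_zero by simp
next
  case False
  let ?F = "\<lambda>t. \<psi> t * \<psi> (a - t)"
  have "(\<Sum>n<p. ?F (a * int n + 0)) = (\<Sum>n<p. ?F (int n))"
  proof (rule sum_residues_affine [OF p_pos coprime_p [OF False]])
    fix s t :: int assume "[s = t] (mod int p)"
    then have "\<psi> s = \<psi> t" "\<psi> (a - s) = \<psi> (a - t)"
      by (auto intro!: cong cong_diff)
    then show "?F s = ?F t" by simp
  qed
  moreover have "?F (a * t + 0) = \<psi> a ^ 2 * (\<psi> t * \<psi> (1 - t))" for t
    using mult [of a "1 - t"] mult [of a t] by (simp add: power2_eq_square algebra_simps)
  ultimately have "(\<Sum>n<p. ?F (int n)) = (\<Sum>n<p. \<psi> a ^ 2 * (\<psi> (int n) * \<psi> (1 - int n)))"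
    by (simp only:)
  then show ?thesis
    by (simp add: conv_def jacobi_def sum_distrib_left mult.commute)
qed

lemma conv_square: "conv p \<psi> (\<lambda>t. \<psi> t ^ 2) a = (if int p dvd a then of_nat p - 1 else -1)"
proof -
  define K where "K = conv p \<psi> (\<lambda>t. \<psi> t ^ 2) 1"
  have norm: "\<psi> t * \<psi> t ^ 2 = (if int p dvd t then 0 else 1)" for t
    using cube [of t] zero [of t] by (simp add: eval_nat_numeral)
  have dvd: "conv p \<psi> (\<lambda>t. \<psi> t ^ 2) b = of_nat p - 1" if "int p dvd b" for b
  proof -
    have "\<psi> (b - t) = \<psi> t" for t
      using cong [of "b - t" "- t"] that uminus [of t] by (simp add: cong_iff_dvd_diff)
    then have "conv p \<psi> (\<lambda>t. \<psi> t ^ 2) b = (\<Sum>n<p. if int p dvd int n then 0 else 1)"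
      by (simp add: conv_def norm)
    also have "\<dots> = (\<Sum>n<p. if n = 0 then 0 else 1)"
      by (intro sum.cong) (auto dest: dvd_imp_le)
    also have "\<dots> = (\<Sum>n<p. 1 - (if n = 0 then 1 else 0))"
      by (intro sum.cong) auto
    also have "\<dots> = of_nat p - 1"
      using p_pos by (simp add: sum_subtractf)
    finally show ?thesis .
  qed
  have ndvd: "conv p \<psi> (\<lambda>t. \<psi> t ^ 2) b = K" if b: "\<not> int p dvd b" for b
  proof -
    let ?F = "\<lambda>t. \<psi> t * \<psi> (b - t) ^ 2"
    have "(\<Sum>n<p. ?F (b * int n + 0)) = (\<Sum>n<p. ?F (int n))"
    proof (rule sum_residues_affine [OF p_pos coprime_p [OF b]])
      fix s t :: int assume "[s = t] (mod int p)"
      then have "\<psi> s = \<psi> t" "\<psi> (b - s) = \<psi> (b - t)"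
        by (auto intro!: cong cong_diff)
      then show "?F s = ?F t" by simp
    qed
    moreover have "?F (b * t + 0) = \<psi> b ^ 3 * (\<psi> t * \<psi> (1 - t) ^ 2)" for t
      using mult [of b "1 - t"] mult [of b t] by (simp add: eval_nat_numeral algebra_simps)
    ultimately have "(\<Sum>n<p. ?F (int n)) = (\<Sum>n<p. \<psi> b ^ 3 * (\<psi> (int n) * \<psi> (1 - int n) ^ 2))"
      by (simp only:)
    then show ?thesis
      using cube [OF b] by (simp add: conv_def K_def)
  qed
  \<comment> \<open>The value \<open>K\<close> at nonzero residues follows from the total mass of the convolution.\<close>
  have "0 = (\<Sum>n<p. \<psi> (int n) * (\<Sum>m<p. \<psi> (1 * int m + (- int n)) ^ 2))"
  proof -
    have "(\<Sum>m<p. \<psi> (1 * int m + (- d)) ^ 2) = (\<Sum>m<p. \<psi> (int m) ^ 2)" for d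
      by (rule sum_residues_affine [OF p_pos]) (auto dest: cong)
    then show ?thesis by (simp add: sum_square_zero)
  qed
  also have "\<dots> = (\<Sum>m<p. conv p \<psi> (\<lambda>t. \<psi> t ^ 2) (int m))"
    unfolding conv_def sum_distrib_left by (subst sum.swap) simp
  also have "\<dots> = (\<Sum>m<p. K + (if m = 0 then of_nat p - 1 - K else 0))"
  proof (rule sum.cong)
    fix m assume "m \<in> {..<p}"
    then have "int p dvd int m \<longleftrightarrow> m = 0"
      by (auto dest: dvd_imp_le)
    then show "conv p \<psi> (\<lambda>t. \<psi> t ^ 2) (int m) = K + (if m = 0 then of_nat p - 1 - K else 0)"
      using dvd [of "int m"] ndvd [of "int m"] by auto
  qed simp
  also have "\<dots> = of_nat p * K + (of_nat p - 1 - K)"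
    using p_pos by (simp add: sum.distrib)
  also have "\<dots> = (of_nat p - 1) * (K + 1)"
    by (simp add: algebra_simps)
  finally have "(of_nat p - 1) * (K + 1) = 0"
    by (rule sym)
  moreover have "(of_nat p - 1 :: eis) \<noteq> 0"
    using p_gt_1 by (simp add: eis_of_nat one_eis_def zero_eis_def)
  ultimately have "K = -1"
    by (simp add: eq_neg_iff_add_eq_0)
  then show ?thesis
    by (simp add: dvd ndvd)
qed

abbreviation G :: "eis poly" where "G \<equiv> gauss_poly p \<psi>"
abbreviation G2 :: "eis poly" where "G2 \<equiv> gauss_poly p (\<lambda>t. \<psi> t ^ 2)"

lemma G_square: "cyc_cong p (G ^ 2) (smult jacobi G2)"
proof -
  have "cyc_cong p (G * G) (gauss_poly p (conv p \<psi> \<psi>))"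
    by (rule gauss_poly_mult [OF p_pos]) (rule cong)
  then show ?thesis
    by (simp add: power2_eq_square gauss_poly_smult conv_self [abs_def])
qed

lemma G_G2: "cyc_cong p (G * G2) (gauss_poly p (\<lambda>a. if int p dvd a then of_nat p - 1 else -1))"
proof -
  have "cyc_cong p (G * G2) (gauss_poly p (conv p \<psi> (\<lambda>t. \<psi> t ^ 2)))"
    by (rule gauss_poly_mult [OF p_pos]) (auto dest: cong)
  then show ?thesis
    by (simp add: conv_square [abs_def])
qed

text \<open>Modulo \<open>X\<^sup>p - 1\<close>, the product \<open>G * G2\<close> is \<open>p - (1 + X + \<dots> + X\<^sup>p\<^sup>-\<^sup>1)\<close>, and
  \<open>G\<close> annihilates \<open>1 + X + \<dots> + X\<^sup>p\<^sup>-\<^sup>1\<close>, because the values of a nontrivial character sum to zero.\<close>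

lemma G_G_G2: "cyc_cong p (G * (G * G2)) (smult (of_nat p) G)"
proof -
  let ?\<Phi> = "gauss_poly p (\<lambda>_. 1)"
  have "cyc_cong p (G * ?\<Phi>) (gauss_poly p (conv p \<psi> (\<lambda>_. 1)))"
    by (rule gauss_poly_mult [OF p_pos]) simp
  also have "conv p \<psi> (\<lambda>_. 1) = (\<lambda>_. 0)"
    by (rule ext) (simp add: conv_def sum_zero)
  finally have *: "cyc_cong p (G * ?\<Phi>) 0"
    by (simp add: gauss_poly_def)
  have "gauss_poly p (\<lambda>a. if int p dvd a then of_nat p - 1 else -1) = [:of_nat p:] - ?\<Phi>"
    using p_pos by (intro poly_eqI) (auto simp: coeff_gauss_poly coeff_pCons split: nat.splits dest: dvd_imp_le)
  then have "cyc_cong p (G * (G * G2)) (G * ([:of_nat p:] - ?\<Phi>))"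
    using G_G2 by (intro cyc_cong_mult) simp_all
  also have "G * ([:of_nat p:] - ?\<Phi>) = smult (of_nat p) G - G * ?\<Phi>"
    by (simp add: algebra_simps)
  also have "cyc_cong p \<dots> (smult (of_nat p) G - 0)"
    by (intro cyc_cong_diff * cyc_cong_refl)
  finally show ?thesis by simp
qed

lemma G_power4: "cyc_cong p (G ^ 4) (smult (jacobi * of_nat p) G)"
proof -
  have "G ^ 4 = G ^ 2 * (G * G)"
    by (simp add: eval_nat_numeral mult.assoc)
  also have "cyc_cong p \<dots> (smult jacobi G2 * (G * G))"
    by (intro cyc_cong_mult G_square cyc_cong_refl)
  also have "\<dots> = smult jacobi (G * (G * G2))"
    by (simp add: algebra_simps)
  also have "cyc_cong p \<dots> (smult jacobi (smult (of_nat p) G))"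
    by (intro cyc_cong_smult G_G_G2)
  finally show ?thesis by simp
qed

lemma G_power7: "cyc_cong p (G ^ 7) (smult (jacobi ^ 2 * of_nat p ^ 2) G)"
proof -
  have "G ^ 7 = G ^ 4 * G ^ 3"
    by (simp flip: power_add)
  also have "cyc_cong p \<dots> (smult (jacobi * of_nat p) G * G ^ 3)"
    by (intro cyc_cong_mult G_power4 cyc_cong_refl)
  also have "\<dots> = smult (jacobi * of_nat p) (G ^ 4)"
    by (simp add: eval_nat_numeral)
  also have "cyc_cong p \<dots> (smult (jacobi * of_nat p) (smult (jacobi * of_nat p) G))"
    by (intro cyc_cong_smult G_power4)
  finally show ?thesis
    by (simp add: power2_eq_square algebra_simps)
qed

text \<open>Evaluating \<open>G\<^sup>2 * G2\<^sup>2\<close> once through \<open>G\<^sup>2 = J G2\<close> and \<open>G2\<^sup>2 = J' G\<close> and once through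
  \<open>G * G2\<close> gives \<open>J J' = p\<close>. The second factor \<open>J'\<close> turns out to be the conjugate of \<open>J\<close>, so this
  is the norm of the Jacobi sum.\<close>

lemma jacobi_mult_jacobi_square:
  "jacobi * (\<Sum>n<p. \<psi> (int n) ^ 2 * \<psi> (1 - int n) ^ 2) = of_nat p"
proof -
  interpret sq: cubic_character p "\<lambda>t. \<psi> t ^ 2"
    by (rule square_character)
  have G2: "cyc_cong p (G2 ^ 2) (smult sq.jacobi G)"
    using sq.G_square by (simp add: power4 flip: power_mult)
  define c where "c = jacobi * sq.jacobi"
  let ?N = "\<lambda>a. if int p dvd a then of_nat p - 1 else -1 :: eis"
  have "smult c (G * G2) = smult jacobi G2 * smult sq.jacobi G"
    by (simp add: c_def algebra_simps)
  also have "cyc_cong p \<dots> (G ^ 2 * G2 ^ 2)"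
    by (intro cyc_cong_mult cyc_cong_sym [OF G_square] cyc_cong_sym [OF G2])
  also have "\<dots> = (G * (G * G2)) * G2"
    by (simp add: eval_nat_numeral algebra_simps)
  also have "cyc_cong p \<dots> (smult (of_nat p) G * G2)"
    by (intro cyc_cong_mult G_G_G2 cyc_cong_refl)
  finally have "cyc_cong p (smult c (G * G2) - smult (of_nat p) (G * G2)) 0"
    by (simp add: cyc_cong_def)
  then have "cyc_cong p (smult (c - of_nat p) (G * G2)) 0"
    by (simp add: smult_diff_left)
  with cyc_cong_smult [OF cyc_cong_sym [OF G_G2], of "c - of_nat p"]
  have "cyc_cong p (gauss_poly p (\<lambda>a. (c - of_nat p) * ?N a)) (smult 0 0)"
    unfolding gauss_poly_smult using cyc_cong_trans by auto
  from cyc_cong_multiple_coeff [OF p_pos this p_gt_1] show ?thesis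
    using p_gt_1 by (simp add: c_def sq.jacobi_def)
qed

text \<open>Modulo a prime \<open>q\<close> the \<open>q\<close>-th power of a polynomial is taken termwise, which replaces \<open>X\<close> by
  \<open>X\<^sup>q\<close>; reindexing the residues undoes this at the cost of the factor \<open>\<psi> q\<close>. Comparing with the
  expression of \<open>G\<^sup>q\<close> through Jacobi sums yields the reciprocity laws at \<open>q = 2\<close> and \<open>q = 7\<close>.\<close>

lemma frobenius:
  assumes q: "prime q" "q \<noteq> p"
  shows "\<exists>Q. cyc_cong p (smult (\<psi> (int q) ^ q) (G ^ q) - gauss_poly p (\<lambda>t. \<psi> t ^ q)) (smult (of_nat q) Q)"
proof -
  have nd: "\<not> int p dvd int q"
    using prime_not_dvd_prime [OF prime q(1)] q(2) by simp
  obtain Q where "G ^ q - (\<Sum>n<p. monom (\<psi> (int n)) n ^ q) = of_nat q * Q"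
    using prime_dvd_power_sum [OF q(1), of "{..<p}" "\<lambda>n. monom (\<psi> (int n)) n"]
    unfolding gauss_poly_def by (auto elim: dvdE)
  then have Q: "G ^ q = (\<Sum>n<p. monom (\<psi> (int n) ^ q) (q * n)) + smult (of_nat q) Q"
    by (simp add: monom_power of_nat_poly algebra_simps)
  let ?F = "\<lambda>t. monom (\<psi> t ^ q) (nat (t mod int p))"
  have "smult (\<psi> (int q) ^ q) (\<Sum>n<p. monom (\<psi> (int n) ^ q) (q * n))
      = (\<Sum>n<p. monom (\<psi> (int q * int n) ^ q) (q * n))"
    by (simp add: smult_sum_right smult_monom mult power_mult_distrib)
  also have "cyc_cong p \<dots> (\<Sum>n<p. monom (\<psi> (int q * int n) ^ q) ((q * n) mod p))"
    by (intro cyc_cong_sum cyc_cong_monom)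
  also have "\<dots> = (\<Sum>n<p. ?F (int q * int n + 0))"
    by (intro sum.cong refl arg_cong2 [of _ _ _ _ monom])
      (simp_all flip: of_nat_mult of_nat_mod)
  also have "\<dots> = (\<Sum>n<p. ?F (int n))"
  proof (rule sum_residues_affine [OF p_pos coprime_p [OF nd]])
    fix s t :: int assume "[s = t] (mod int p)"
    then show "?F s = ?F t"
      using cong [of s t] by (simp add: cong_def)
  qed
  also have "\<dots> = gauss_poly p (\<lambda>t. \<psi> t ^ q)"
    by (simp add: gauss_poly_def)
  finally have *: "cyc_cong p (smult (\<psi> (int q) ^ q) (\<Sum>n<p. monom (\<psi> (int n) ^ q) (q * n)))
    (gauss_poly p (\<lambda>t. \<psi> t ^ q))" .
  have "cyc_cong p (smult (\<psi> (int q) ^ q) (G ^ q) - gauss_poly p (\<lambda>t. \<psi> t ^ q))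
     (smult (of_nat q) (smult (\<psi> (int q) ^ q) Q))"
    using * by (simp add: Q cyc_cong_def smult_add_right algebra_simps)
  then show ?thesis by blast
qed

lemma jacobi_mod_2:
  assumes "p \<noteq> 2"
  shows "2 dvd \<psi> 2 ^ 2 * jacobi - 1"
proof -
  obtain Q where Q: "cyc_cong p (smult (\<psi> 2 ^ 2) (G ^ 2) - G2) (smult 2 Q)"
    using frobenius [of 2] assms by auto
  have "smult (\<psi> 2 ^ 2 * jacobi) G2 - G2 = smult (\<psi> 2 ^ 2) (smult jacobi G2) - G2"
    by simp
  also have "cyc_cong p \<dots> (smult (\<psi> 2 ^ 2) (G ^ 2) - G2)"
    by (intro cyc_cong_diff cyc_cong_smult cyc_cong_sym [OF G_square] cyc_cong_refl)
  also note Q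
  finally have "cyc_cong p (gauss_poly p (\<lambda>t. \<psi> 2 ^ 2 * jacobi * \<psi> t ^ 2 - \<psi> t ^ 2)) (smult 2 Q)"
    by (simp add: gauss_poly_smult gauss_poly_diff)
  from cyc_cong_multiple_coeff [OF p_pos this p_gt_1] show ?thesis
    by (simp add: one)
qed

lemma jacobi_mod_7:
  assumes "p \<noteq> 7"
  shows "7 dvd \<psi> 7 * jacobi ^ 2 * of_nat p ^ 2 - 1"
proof -
  have pow7: "\<psi> t ^ 7 = \<psi> t" for t
  proof -
    have "\<psi> t ^ 7 = \<psi> t ^ 4 * \<psi> t ^ 3"
      by (simp flip: power_add)
    also have "\<dots> = \<psi> t ^ 4"
      by (metis cube_or_zero mult_1_right mult_zero_left power4)
    finally show ?thesis by (simp add: power4)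
  qed
  obtain Q where Q: "cyc_cong p (smult (\<psi> 7) (G ^ 7) - G) (smult 7 Q)"
    using frobenius [of 7] assms by (auto simp: pow7)
  have "smult (\<psi> 7 * (jacobi ^ 2 * of_nat p ^ 2)) G - G
      = smult (\<psi> 7) (smult (jacobi ^ 2 * of_nat p ^ 2) G) - G"
    by simp
  also have "cyc_cong p \<dots> (smult (\<psi> 7) (G ^ 7) - G)"
    by (intro cyc_cong_diff cyc_cong_smult cyc_cong_sym [OF G_power7] cyc_cong_refl)
  also note Q
  finally have "cyc_cong p (gauss_poly p (\<lambda>t. \<psi> 7 * (jacobi ^ 2 * of_nat p ^ 2) * \<psi> t - \<psi> t)) (smult 7 Q)"
    by (simp add: gauss_poly_smult gauss_poly_diff)
  from cyc_cong_multiple_coeff [OF p_pos this p_gt_1] show ?thesis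
    by (simp add: one mult.assoc)
qed

end

section \<open>The cubic residue symbol of a split prime\<close>

text \<open>The differences \<open>(n + 1)\<^sup>k\<^sup>+\<^sup>1 - n\<^sup>k\<^sup>+\<^sup>1\<close> telescope to \<open>p\<^sup>k\<^sup>+\<^sup>1\<close>. Expanding them expresses
  \<open>k + 1\<close>, a unit modulo \<open>p\<close>, times the \<open>k\<close>-th power sum by lower power sums.\<close>

lemma prime_dvd_power_sum_residues:
  assumes p: "prime p" and k: "k < p - 1"
  shows "int p dvd (\<Sum>n<p. int n ^ k)"
  using k
proof (induction k rule: less_induct)
  case (less k)
  have "(\<Sum>i\<le>k. int (Suc k choose i) * (\<Sum>n<p. int n ^ i))
      = (\<Sum>n<p. \<Sum>i\<le>k. int (Suc k choose i) * int n ^ i)"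
    unfolding sum_distrib_left by (rule sum.swap)
  also have "\<dots> = (\<Sum>n<p. int (Suc n) ^ Suc k - int n ^ Suc k)"
  proof (rule sum.cong)
    fix n
    have "int (Suc n) ^ Suc k = (int n + 1) ^ Suc k"
      by (simp add: add.commute)
    also have "\<dots> = (\<Sum>i\<le>Suc k. int (Suc k choose i) * int n ^ i)"
      by (simp only: binomial_ring power_one mult_1_right of_nat_id)
    finally show "(\<Sum>i\<le>k. int (Suc k choose i) * int n ^ i) = int (Suc n) ^ Suc k - int n ^ Suc k"
      by simp
  qed simp
  also have "\<dots> = int p ^ Suc k"
    using sum_lessThan_telescope [of "\<lambda>n. int n ^ Suc k" p] by simp
  finally have sum: "(\<Sum>i\<le>k. int (Suc k choose i) * (\<Sum>n<p. int n ^ i)) = int p ^ Suc k" .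
  have "int p dvd (\<Sum>i<k. int (Suc k choose i) * (\<Sum>n<p. int n ^ i))"
  proof (rule dvd_sum)
    fix i assume "i \<in> {..<k}"
    then show "int p dvd int (Suc k choose i) * (\<Sum>n<p. int n ^ i)"
      using less.IH [of i] less.prems by simp
  qed
  moreover have "int p dvd (\<Sum>i\<le>k. int (Suc k choose i) * (\<Sum>n<p. int n ^ i))"
    unfolding sum by simp
  moreover have "(\<Sum>i\<le>k. int (Suc k choose i) * (\<Sum>n<p. int n ^ i))
    = (\<Sum>i<k. int (Suc k choose i) * (\<Sum>n<p. int n ^ i)) + int (Suc k) * (\<Sum>n<p. int n ^ k)"
    by (simp add: lessThan_Suc_atMost [symmetric])
  ultimately have "int p dvd int (Suc k) * (\<Sum>n<p. int n ^ k)"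
    by (simp only: dvd_add_right_iff)
  moreover have "\<not> int p dvd int (Suc k)"
    unfolding int_dvd_int_iff using less.prems by (auto dest!: dvd_imp_le)
  moreover have "prime (int p)"
    using p by simp
  ultimately show ?case
    using prime_dvd_mult_iff by blast
qed

locale split_prime =
  fixes p :: nat and w :: int
  assumes prime_p: "prime p" and p_not_3: "p \<noteq> 3"
    and root: "[w\<^sup>2 + w + 1 = 0] (mod int p)"
begin

definition exponent :: nat where "exponent = (p - 1) div 3"

text \<open>The cubic residue symbol for the prime above \<open>p\<close> that contains \<open>\<omega> - w\<close>: the cube root of unity
  in the Eisenstein integers that reduces to \<open>t\<close> to the power \<open>(p - 1) / 3\<close>.\<close>

definition symbol :: "int \<Rightarrow> eis"
  where "symbol t = (if int p dvd t then 0 else if [t ^ exponent = 1] (mod int p) then 1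
    else if [t ^ exponent = w] (mod int p) then \<omega> else \<omega>\<^sup>2)"

definition symbol_values :: "eis set" where "symbol_values = {0, 1, \<omega>, \<omega>\<^sup>2}"

lemma prime_int_p: "prime (int p)"
  using prime_p by simp

lemma not_dvd_3: "\<not> int p dvd 3"
  using prime_not_dvd_prime [OF prime_p, of 3] p_not_3 by simp

lemma fermat: "\<not> int p dvd t \<Longrightarrow> [t ^ (p - 1) = 1] (mod int p)"
proof -
  assume t: "\<not> int p dvd t"
  define n where "n = nat (t mod int p)"
  have p0: "p > 0" using prime_p by (simp add: prime_gt_0_nat)
  have n: "[int n = t] (mod int p)"
    using p0 by (simp add: n_def cong_def)
  then have "\<not> p dvd n"
    using t by (metis cong_dvd_iff cong_sym int_dvd_int_iff)
  then have "[n ^ (p - 1) = 1] (mod p)"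
    using fermat_theorem [OF prime_p] by blast
  then have "[int n ^ (p - 1) = 1] (mod int p)"
    by (metis cong_int_iff of_nat_1 of_nat_power)
  then show ?thesis
    using cong_pow [OF n, of "p - 1"] by (metis cong_sym cong_trans)
qed

lemma root_cube: "[w ^ 3 = 1] (mod int p)"
proof -
  have "w ^ 3 - 1 = (w - 1) * (w\<^sup>2 + w + 1)"
    by (simp add: eval_nat_numeral algebra_simps)
  then show ?thesis
    using root by (simp add: cong_iff_dvd_diff)
qed

lemma root_not_1: "\<not> int p dvd w - 1"
proof
  assume *: "int p dvd w - 1"
  have "3 = (w\<^sup>2 + w + 1) - (w - 1) * (w + 2)"
    by (simp add: eval_nat_numeral algebra_simps)
  also have "int p dvd \<dots>"
    using * root by (intro dvd_diff) (auto simp: cong_0_iff)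
  finally show False using not_dvd_3 by simp
qed

lemma p_eq: "p = 3 * exponent + 1" and exponent_pos: "exponent > 0"
proof -
  have nd: "\<not> int p dvd w"
  proof
    assume "int p dvd w"
    then have "int p dvd w ^ 3"
      by (simp add: eval_nat_numeral)
    then show False
      using cong_dvd_iff [OF root_cube] prime_int_p not_prime_unit by blast
  qed
  define m where "m = (p - 1) div 3"
  have p1: "p > 1" using prime_gt_1_nat [OF prime_p] .
  have w3: "[w ^ (3 * m) = 1] (mod int p)"
    using cong_pow [OF root_cube, of m] by (simp add: power_mult)
  have "(p - 1) mod 3 = 0"
  proof (rule ccontr)
    assume "(p - 1) mod 3 \<noteq> 0"
    then have "p - 1 = 3 * m + 1 \<or> p - 1 = 3 * m + 2"
      unfolding m_def by presburger
    then consider "p - 1 = 3 * m + 1" | "p - 1 = 3 * m + 2"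
      by blast
    then show False
    proof cases
      case 1
      then have "[w ^ (3 * m) * w = 1] (mod int p)"
        using fermat [OF nd] by (simp add: mult.commute)
      then have "[w = 1] (mod int p)"
        using cong_scalar_right [OF w3, of w] by (metis cong_sym cong_trans mult_1)
      then show False
        using root_not_1 by (simp add: cong_iff_dvd_diff)
    next
      case 2
      then have "[w ^ (3 * m) * w ^ 2 = 1] (mod int p)"
        using fermat [OF nd] by (simp only: power_add)
      then have "[w ^ 2 = 1] (mod int p)"
        using cong_scalar_right [OF w3, of "w ^ 2"] by (metis cong_sym cong_trans mult_1)
      then have "[w ^ 2 * w = 1 * w] (mod int p)"
        by (rule cong_scalar_right)
      then have "[w = w ^ 3] (mod int p)"
        by (simp add: eval_nat_numeral cong_sym mult.commute)
      then have "[w = 1] (mod int p)"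
        using root_cube by (rule cong_trans)
      then show False
        using root_not_1 by (simp add: cong_iff_dvd_diff)
    qed
  qed
  then show p: "p = 3 * exponent + 1"
    unfolding exponent_def using p1 by presburger
  show "exponent > 0"
    using p p1 by presburger
qed

lemma eval_omega: "eis_eval w \<omega> = w" and eval_omega_square: "eis_eval w (\<omega>\<^sup>2) = - 1 - w"
  by (simp_all add: eis_eval_def omega_square) (simp add: \<omega>_def)

lemma eval_inj_values:
  assumes "c \<in> symbol_values" "d \<in> symbol_values" "[eis_eval w c = eis_eval w d] (mod int p)"
  shows "c = d"
proof -
  have *: "int p dvd eis_eval w c - eis_eval w d"
    using assms(3) by (simp add: cong_iff_dvd_diff)
  have r: "int p dvd w\<^sup>2 + w + 1"
    using root by (simp add: cong_0_iff)
  have unit: "\<not> int p dvd a" if "a * b = 1 + k * (w\<^sup>2 + w + 1) \<or> a * b = 3 + k * (w\<^sup>2 + w + 1)" for a b k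
  proof
    assume "int p dvd a"
    then have "int p dvd a * b - k * (w\<^sup>2 + w + 1)"
      using r by simp
    then have "int p dvd 1 \<or> int p dvd 3"
      using that by auto
    then show False
      using not_dvd_3 prime_int_p by (auto simp: not_prime_unit)
  qed
  have u1: "\<not> int p dvd 1" by (rule unit [of _ 1 0]) simp
  have u2: "\<not> int p dvd w"
    by (rule unit [of _ "-1 - w" "-1"]) (simp add: eval_nat_numeral algebra_simps)
  have u3: "\<not> int p dvd -1 - w"
    by (rule unit [of _ "w" "-1"]) (simp add: eval_nat_numeral algebra_simps)
  have u4: "\<not> int p dvd 1 - w"
    by (rule unit [of _ "w + 2" "-1"]) (simp add: eval_nat_numeral algebra_simps)
  have u5: "\<not> int p dvd - 1 - w - 1"
    by (rule unit [of _ "w - 1" "-1"]) (simp add: eval_nat_numeral algebra_simps)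
  have u6: "\<not> int p dvd - 1 - w - w"
    by (rule unit [of _ "2 * w + 1" "-4"]) (simp add: eval_nat_numeral algebra_simps)
  have "\<not> int p dvd - (1 :: int)" "\<not> int p dvd - w" "\<not> int p dvd - (-1 - w)" "\<not> int p dvd w - 1"
    "\<not> int p dvd 1 - (-1 - w)" "\<not> int p dvd w - (-1 - w)"
    using u1 u2 u3 u4 u5 u6 by (metis dvd_minus_iff minus_diff_eq)+
  with u1 u2 u3 u4 u5 u6 show ?thesis
    using assms(1,2) * unfolding symbol_values_def
    by (elim insertE emptyE) (simp_all only: eval_0 eval_1 eval_omega eval_omega_square diff_0_right diff_0)
qed

lemma symbol_in_values: "symbol t \<in> symbol_values"
  by (simp add: symbol_def symbol_values_def)

lemma eval_symbol: "[eis_eval w (symbol t) = t ^ exponent] (mod int p)"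
proof (cases "int p dvd t")
  case True
  then have "int p dvd t ^ exponent"
    using exponent_pos by (simp add: dvd_power_iff_le dvd_trans [OF _ dvd_power])
  then show ?thesis
    using True by (simp add: symbol_def cong_0_iff cong_sym_eq [of 0])
next
  case False
  define y where "y = t ^ exponent"
  have "[y ^ 3 = 1] (mod int p)"
  proof -
    have "p - 1 = exponent * 3"
      using p_eq by simp
    then show ?thesis
      using fermat [OF False] by (simp only: y_def power_mult)
  qed
  moreover obtain k where k: "w\<^sup>2 + w + 1 = int p * k"
    using root by (auto simp: cong_0_iff)
  have "(y - 1) * ((y - w) * (y - (- 1 - w))) = (y ^ 3 - 1) - (y - 1) * (w\<^sup>2 + w + 1)"
    by (simp add: eval_nat_numeral algebra_simps)
  ultimately have "int p dvd (y - 1) * ((y - w) * (y - (- 1 - w)))"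
    by (simp add: cong_iff_dvd_diff k)
  then have "[y = 1] (mod int p) \<or> [y = w] (mod int p) \<or> [y = - 1 - w] (mod int p)"
    using prime_int_p by (simp only: prime_dvd_mult_iff cong_iff_dvd_diff)
  then show ?thesis
    using False by (auto simp: symbol_def eval_omega eval_omega_square cong_sym_eq simp flip: y_def)
qed

lemma symbolI:
  assumes "c \<in> symbol_values" "[eis_eval w c = t ^ exponent] (mod int p)"
  shows "symbol t = c"
  using symbol_in_values assms(1) cong_trans [OF eval_symbol cong_sym [OF assms(2)]]
  by (rule eval_inj_values)

lemma symbol_values_eq: "symbol_values = {Eis 0 0, Eis 1 0, Eis 0 1, Eis (- 1) (- 1)}"
  by (simp add: symbol_values_def omega_square) (simp add: \<omega>_def zero_eis_def one_eis_def)

lemma values_mult: "c \<in> symbol_values \<Longrightarrow> d \<in> symbol_values \<Longrightarrow> c * d \<in> symbol_values"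
  by (auto simp: symbol_values_eq)

lemma values_cube: "c \<in> symbol_values \<Longrightarrow> c \<noteq> 0 \<Longrightarrow> c ^ 3 = 1"
  by (auto simp: symbol_values_eq zero_eis_def one_eis_def power3_eq_cube)

lemma values_cnj: "c \<in> symbol_values \<Longrightarrow> eis_cnj c = c\<^sup>2"
  by (auto simp: symbol_values_eq eis_cnj_def power2_eq_square)

sublocale cubic_character p symbol
proof
  show "prime p" by (rule prime_p)
  show eq: "symbol s = symbol t" if "[s = t] (mod int p)" for s t
    using that by (intro symbolI symbol_in_values)
      (metis cong_pow cong_sym cong_trans eval_symbol)
  show "symbol (s * t) = symbol s * symbol t" for s t
  proof (rule symbolI)
    show "symbol s * symbol t \<in> symbol_values"
      by (intro values_mult symbol_in_values)
    show "[eis_eval w (symbol s * symbol t) = (s * t) ^ exponent] (mod int p)"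
      unfolding power_mult_distrib
      by (rule cong_trans [OF eval_mult [OF root]]) (intro cong_mult eval_symbol)
  qed
  show zero: "symbol t = 0 \<longleftrightarrow> int p dvd t" for t
    by (auto simp: symbol_def \<omega>_def zero_eis_def one_eis_def power2_eq_square)
  show "symbol t ^ 3 = 1" if "\<not> int p dvd t" for t
    using that by (intro values_cube symbol_in_values) (simp add: zero)
  show "\<exists>t. \<not> int p dvd t \<and> symbol t \<noteq> 1"
  proof (rule ccontr)
    assume *: "\<not> ?thesis"
    \<comment> \<open>Otherwise every nonzero residue contributes \<open>1\<close> to a power sum divisible by \<open>p\<close>.\<close>
    have "int p dvd (\<Sum>n<p. int n ^ exponent)"
      using p_eq exponent_pos by (intro prime_dvd_power_sum_residues prime_p) linarith
    moreover have "[(\<Sum>n<p. int n ^ exponent) = (\<Sum>n<p. if n = 0 then 0 else 1)] (mod int p)"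
    proof (rule cong_sum)
      fix n assume "n \<in> {..<p}"
      then have "n \<noteq> 0 \<Longrightarrow> \<not> int p dvd int n"
        by (auto dest: dvd_imp_le)
      then have "n \<noteq> 0 \<Longrightarrow> symbol (int n) = 1"
        using * by blast
      then show "[int n ^ exponent = (if n = 0 then 0 else 1)] (mod int p)"
        using eval_symbol [of "int n"] exponent_pos
        by (cases "n = 0") (simp_all add: zero_power cong_sym)
    qed
    moreover have "(\<Sum>n<p. if n = 0 then 0 else 1 :: int) = (\<Sum>n<p. 1 - (if n = 0 then 1 else 0))"
      by (intro sum.cong) auto
    moreover have "\<dots> = int p - 1"
      using prime_p by (simp add: sum_subtractf prime_gt_0_nat)
    ultimately have "int p dvd int p - 1"
      by (metis cong_dvd_iff)
    then have "int p dvd 1"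
      by (metis dvd_diff_commute dvd_diff_left_iff dvd_refl)
    then show False
      using prime_int_p not_prime_unit by blast
  qed
qed

text \<open>Modulo the prime, the Jacobi sum is the sum of \<open>n\<^sup>m (1 - n)\<^sup>m\<close> with \<open>m = (p - 1) / 3\<close>, a
  polynomial in \<open>n\<close> of degree \<open>2 m < p - 1\<close>, and such power sums vanish. So the Jacobi sum lies in the
  prime ideal that defines the symbol, and since its norm is \<open>p\<close> it generates this ideal.\<close>

lemma eval_jacobi: "[eis_eval w jacobi = 0] (mod int p)"
proof -
  let ?m = exponent
  have "[eis_eval w jacobi = (\<Sum>n<p. int n ^ ?m * (1 - int n) ^ ?m)] (mod int p)"
    unfolding jacobi_def eval_sum
  proof (rule cong_sum)
    fix n
    have "[eis_eval w (symbol (int n)) * eis_eval w (symbol (1 - int n)) = int n ^ ?m * (1 - int n) ^ ?m] (mod int p)"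
      by (intro cong_mult eval_symbol)
    with eval_mult [OF root]
    show "[eis_eval w (symbol (int n) * symbol (1 - int n)) = int n ^ ?m * (1 - int n) ^ ?m] (mod int p)"
      by (rule cong_trans)
  qed
  also have "(\<Sum>n<p. int n ^ ?m * (1 - int n) ^ ?m)
      = (\<Sum>n<p. \<Sum>i\<le>?m. int (?m choose i) * (-1) ^ i * int n ^ (?m + i))"
  proof (rule sum.cong)
    fix n
    have "(1 - int n) ^ ?m = (- int n + 1) ^ ?m"
      by simp
    also have "\<dots> = (\<Sum>i\<le>?m. int (?m choose i) * (- int n) ^ i)"
      by (simp only: binomial_ring power_one mult_1_right of_nat_id)
    finally show "int n ^ ?m * (1 - int n) ^ ?m
        = (\<Sum>i\<le>?m. int (?m choose i) * (-1) ^ i * int n ^ (?m + i))"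
      by (simp add: sum_distrib_left power_minus [of "int n"] power_add mult_ac)
  qed simp
  also have "\<dots> = (\<Sum>i\<le>?m. int (?m choose i) * (-1) ^ i * (\<Sum>n<p. int n ^ (?m + i)))"
    unfolding sum_distrib_left by (rule sum.swap)
  also have "[\<dots> = 0] (mod int p)"
    unfolding cong_0_iff using p_eq exponent_pos
    by (intro dvd_sum dvd_mult prime_dvd_power_sum_residues prime_p) auto
  finally show ?thesis .
qed

lemma norm_jacobi: "eis_norm jacobi = int p"
proof -
  have "eis_cnj jacobi = (\<Sum>n<p. symbol (int n) ^ 2 * symbol (1 - int n) ^ 2)"
    by (simp add: jacobi_def cnj_sum cnj_mult values_cnj symbol_in_values)
  then have "of_int (eis_norm jacobi) = (of_nat p :: eis)"
    using jacobi_mult_jacobi_square mult_cnj [of jacobi] by simp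
  then show ?thesis
    by (simp add: eis_of_int eis_of_nat)
qed

end

section \<open>The joint obstruction modulo 2 and modulo 7\<close>

text \<open>For a product \<open>u\<close> of Jacobi sums, the residue of \<open>u\<close> modulo 2 is the product of the values of
  the symbols at 2, and the residue of \<open>u\<^sup>4\<close> times the squared conjugate modulo 7 is the inverse of
  the product of the values at 7. Hence \<open>u\<close> is coherent when the symbols at \<open>28 = 2\<^sup>2 * 7\<close> multiply
  to 1. The condition is insensitive to units, so that associates need not be normalised.\<close>

definition coherent :: "eis \<Rightarrow> bool"
  where "coherent u \<longleftrightarrow> (\<exists>c. c ^ 3 = 1 \<and> 2 dvd u - c \<and> 7 dvd u ^ 4 * eis_cnj u ^ 2 - c ^ 2)"

lemma dvd_mult_diff:
  fixes a b c d n :: "'a :: comm_ring_1"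
  assumes "n dvd a - b" "n dvd c - d"
  shows "n dvd a * c - b * d"
proof -
  have "a * c - b * d = (a - b) * c + b * (c - d)"
    by (simp add: algebra_simps)
  then show ?thesis using assms by simp
qed

lemma coherent_mult:
  assumes "coherent u" "coherent v"
  shows "coherent (u * v)"
proof -
  obtain c where c: "c ^ 3 = 1" "2 dvd u - c" "7 dvd u ^ 4 * eis_cnj u ^ 2 - c ^ 2"
    using assms(1) by (auto simp: coherent_def)
  obtain d where d: "d ^ 3 = 1" "2 dvd v - d" "7 dvd v ^ 4 * eis_cnj v ^ 2 - d ^ 2"
    using assms(2) by (auto simp: coherent_def)
  have "(u * v) ^ 4 * eis_cnj (u * v) ^ 2 - (c * d) ^ 2
      = (u ^ 4 * eis_cnj u ^ 2) * (v ^ 4 * eis_cnj v ^ 2) - c ^ 2 * d ^ 2"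
    by (simp add: cnj_mult power_mult_distrib mult_ac)
  then have "7 dvd (u * v) ^ 4 * eis_cnj (u * v) ^ 2 - (c * d) ^ 2"
    using dvd_mult_diff [OF c(3) d(3)] by (simp only:)
  moreover have "(c * d) ^ 3 = 1"
    using c d by (simp add: power_mult_distrib)
  ultimately show ?thesis
    unfolding coherent_def using dvd_mult_diff [OF c(2) d(2)] by blast
qed

lemma coherent_unit:
  assumes "eis_norm u = 1"
  shows "coherent u"
proof -
  obtain k s where u: "u = s * \<omega> ^ k" and s: "s = 1 \<or> s = -1"
    using norm_1_cases [OF assms] .
  have cube: "(\<omega> ^ k) ^ 3 = 1"
    using omega_cube by (metis mult.commute power_mult power_one)
  have "2 dvd u - \<omega> ^ k"
  proof -
    have "- (\<omega> ^ k) - \<omega> ^ k = 2 * (- (\<omega> ^ k))" by simp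
    then show ?thesis
      using s u by (metis diff_self dvd_0_right dvd_triv_left mult_1 mult_minus1)
  qed
  moreover have "u ^ 4 * eis_cnj u ^ 2 = (u * eis_cnj u) ^ 2 * u ^ 2"
    by (simp add: eval_nat_numeral mult_ac)
  then have "u ^ 4 * eis_cnj u ^ 2 = (\<omega> ^ k) ^ 2"
    using s u assms by (auto simp: mult_cnj power_mult_distrib)
  ultimately show ?thesis
    unfolding coherent_def using cube by auto
qed

context split_prime
begin

lemma jacobi_mod_7_power: "jacobi ^ 4 * eis_cnj jacobi ^ 2 = jacobi ^ 2 * of_nat p ^ 2"
proof -
  have "jacobi ^ 4 * eis_cnj jacobi ^ 2 = jacobi ^ 2 * (jacobi * eis_cnj jacobi) ^ 2"
    by (simp add: eval_nat_numeral mult_ac)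
  then show ?thesis
    by (simp add: mult_cnj norm_jacobi)
qed

text \<open>If 28 is a cube modulo \<open>p\<close>, then \<open>\<psi> 2\<^sup>2 * \<psi> 7 = 1\<close>. So the inverse of \<open>\<psi> 7\<close>, to which
  \<open>J\<^sup>4\<close> times the squared conjugate of \<open>J\<close> is congruent modulo 7, is the square of \<open>\<psi> 2\<close>, to which
  \<open>J\<close> is congruent modulo 2.\<close>

lemma coherent_jacobi:
  assumes p: "p \<noteq> 2" "p \<noteq> 7" and c: "[c ^ 3 = 28] (mod int p)"
  shows "coherent jacobi"
proof -
  have nd2: "\<not> int p dvd 2" and nd7: "\<not> int p dvd 7"
    using p prime_not_dvd_prime [OF prime_p, of 2] prime_not_dvd_prime [OF prime_p, of 7] by simp_all
  have "\<not> int p dvd 28"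
  proof
    assume "int p dvd 28"
    then have "int p dvd 2 * (2 * 7)" by simp
    then show False using nd2 nd7 prime_int_p by (simp only: prime_dvd_mult_iff) blast
  qed
  then have "symbol 28 \<noteq> 0"
    by (simp add: zero)
  moreover have "symbol 28 = symbol c ^ 3"
    using cong [OF c] by (simp add: power)
  ultimately have "symbol 28 = 1"
    using cube_or_zero [of c] by auto
  then have "symbol 2 * (symbol 2 * symbol 7) = 1"
    using mult [of 2 "2 * 7"] mult [of 2 7] by simp
  moreover have "symbol 2 ^ 3 * symbol 7 = symbol 2 * (symbol 2 * (symbol 2 * symbol 7))"
    by (simp add: power3_eq_cube mult.assoc)
  ultimately have "symbol 2 ^ 3 * symbol 7 = symbol 2"
    by simp
  then have 7: "symbol 7 = symbol 2"
    using cube [OF nd2] by simp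
  have "symbol 2 * (symbol 2 ^ 2 * jacobi - 1) = symbol 2 ^ 3 * jacobi - symbol 2"
    by (simp add: eval_nat_numeral algebra_simps)
  then have "2 dvd jacobi - symbol 2"
    using dvd_mult [OF jacobi_mod_2 [OF p(1)], of "symbol 2"] cube [OF nd2] by simp
  moreover have "symbol 2 ^ 2 * (symbol 7 * jacobi ^ 2 * of_nat p ^ 2 - 1)
      = symbol 2 ^ 3 * (jacobi ^ 2 * of_nat p ^ 2) - symbol 2 ^ 2"
    by (simp add: 7 eval_nat_numeral algebra_simps)
  then have "7 dvd jacobi ^ 4 * eis_cnj jacobi ^ 2 - symbol 2 ^ 2"
    using dvd_mult [OF jacobi_mod_7 [OF p(2)], of "symbol 2 ^ 2"] cube [OF nd2]
    by (simp add: jacobi_mod_7_power)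
  ultimately show ?thesis
    unfolding coherent_def using cube [OF nd2] by blast
qed

lemma coherent_jacobi_cube:
  assumes p: "p \<noteq> 2" "p \<noteq> 7"
  shows "coherent (jacobi ^ 3)"
proof -
  have nd2: "\<not> int p dvd 2" and nd7: "\<not> int p dvd 7"
    using p prime_not_dvd_prime [OF prime_p, of 2] prime_not_dvd_prime [OF prime_p, of 7] by simp_all
  have cubes: "n dvd a ^ 3 - 1" if "n dvd a - 1" for n a :: eis
    using dvd_mult_diff [OF that dvd_mult_diff [OF that that]] by (simp add: eval_nat_numeral)
  have "(symbol 2 ^ 2 * jacobi) ^ 3 = (symbol 2 ^ 3) ^ 2 * jacobi ^ 3"
    by (simp add: power_mult_distrib flip: power_mult)
  then have "2 dvd jacobi ^ 3 - 1"
    using cubes [OF jacobi_mod_2 [OF p(1)]] cube [OF nd2] by simp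
  moreover have "(symbol 7 * jacobi ^ 2 * of_nat p ^ 2) ^ 3 = (jacobi ^ 4 * eis_cnj jacobi ^ 2) ^ 3"
    using cube [OF nd7] by (simp add: power_mult_distrib [of "symbol 7"] mult.assoc jacobi_mod_7_power)
  then have "7 dvd (jacobi ^ 4 * eis_cnj jacobi ^ 2) ^ 3 - 1"
    using cubes [OF jacobi_mod_7 [OF p(2)]] by simp
  moreover have "(jacobi ^ 4 * eis_cnj jacobi ^ 2) ^ 3 = (jacobi ^ 3) ^ 4 * eis_cnj (jacobi ^ 3) ^ 2"
    by (simp add: cnj_power power_mult_distrib flip: power_mult)
  ultimately have "2 dvd jacobi ^ 3 - 1" "7 dvd (jacobi ^ 3) ^ 4 * eis_cnj (jacobi ^ 3) ^ 2 - 1 ^ 2"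
    by simp_all
  then show ?thesis
    unfolding coherent_def by (meson power_one)
qed

end

text \<open>Descent on the norm: split off the Jacobi sum of a prime \<open>p\<close> that divides it. If \<open>p\<close> divides
  \<open>m\<close>, this Jacobi sum is coherent; otherwise \<open>p\<close> divides \<open>g\<close>, its cube splits off, and cubes of
  Jacobi sums are always coherent.\<close>

lemma coherent_of_norm:
  assumes "primitive u" "eis_norm u = int (g ^ 3 * m)"
    and "\<And>p. prime p \<Longrightarrow> p dvd g * m \<Longrightarrow> p \<noteq> 2 \<and> p \<noteq> 3 \<and> p \<noteq> 7"
    and "\<And>p. prime p \<Longrightarrow> p dvd m \<Longrightarrow> \<exists>c. [c ^ 3 = 28] (mod int p)"
    and "g * m > 0"
  shows "coherent u"
  using assms
proof (induction "g * m" arbitrary: g m u rule: less_induct)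
  case less
  show ?case
  proof (cases "g * m = 1")
    case True
    then show ?thesis
      using less.prems(2) by (intro coherent_unit) simp
  next
    case False
    then obtain p where p: "prime p" "p dvd g * m"
      using prime_factor_nat by blast
    have p_ne: "p \<noteq> 2" "p \<noteq> 3" "p \<noteq> 7" and p1: "p > 1"
      using less.prems(3) [OF p] prime_gt_1_nat [OF p(1)] by simp_all
    have pi: "prime (int p)"
      using p by simp
    have "p dvd g ^ 3 * m"
      using p by (auto simp: prime_dvd_mult_iff eval_nat_numeral)
    then have dvd: "int p dvd eis_norm u"
      unfolding less.prems(2) int_dvd_int_iff .
    obtain w where w: "[w\<^sup>2 + w + 1 = 0] (mod int p)" "[eis_eval w u = 0] (mod int p)"
      using primitive_prime_root [OF pi less.prems(1) dvd] .
    interpret split_prime p w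
      by standard (use p p_ne w in auto)
    note power_dvd = primitive_eval_zero_power_dvd [OF pi w(1) norm_jacobi eval_jacobi less.prems(1) w(2)]
    show ?thesis
    proof (cases "p dvd m")
      case True
      then obtain k where k: "m = p * k" ..
      have "jacobi dvd u"
        using power_dvd [of 1] dvd by simp
      then obtain v where v: "u = jacobi * v" ..
      have "int p * eis_norm v = int p * int (g ^ 3 * k)"
        using less.prems(2) by (simp add: v k norm_mult norm_jacobi)
      then have nv: "eis_norm v = int (g ^ 3 * k)"
        using p1 by simp
      have "coherent v"
      proof (rule less.hyps [OF _ _ nv])
        show "g * k < g * m" "g * k > 0"
          using less.prems(5) p1 by (simp_all add: k)
        show "primitive v"
          using less.prems(1) primitive_mult_right by (simp add: v)
        fix q :: nat assume "prime q"
        show "q dvd g * k \<Longrightarrow> q \<noteq> 2 \<and> q \<noteq> 3 \<and> q \<noteq> 7"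
          using less.prems(3) [OF \<open>prime q\<close>] dvd_mult [of q "g * k" p] by (simp add: k mult.left_commute)
        show "q dvd k \<Longrightarrow> \<exists>c. [c ^ 3 = 28] (mod int q)"
          using less.prems(4) [OF \<open>prime q\<close>] by (simp add: k)
      qed
      moreover obtain c where "[c ^ 3 = 28] (mod int p)"
        using less.prems(4) [OF p(1) True] by blast
      ultimately show ?thesis
        unfolding v using coherent_jacobi p_ne coherent_mult by blast
    next
      case False
      then have "p dvd g"
        using p by (simp add: prime_dvd_mult_iff)
      then obtain k where k: "g = p * k" ..
      have "int p ^ 3 dvd eis_norm u"
        using less.prems(2) by (simp add: k power_mult_distrib mult.assoc)
      then have "jacobi ^ 3 dvd u"
        by (rule power_dvd)
      then obtain v where v: "u = jacobi ^ 3 * v" ..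
      have "int p ^ 3 * eis_norm v = int p ^ 3 * int (k ^ 3 * m)"
        using less.prems(2) by (simp add: v k norm_mult norm_power norm_jacobi power_mult_distrib)
      then have nv: "eis_norm v = int (k ^ 3 * m)"
        using p1 by simp
      have "coherent v"
      proof (rule less.hyps [OF _ _ nv])
        show "k * m < g * m" "k * m > 0"
          using less.prems(5) p1 by (simp_all add: k)
        show "primitive v"
          using less.prems(1) primitive_mult_right by (simp add: v)
        fix q :: nat assume "prime q"
        show "q dvd k * m \<Longrightarrow> q \<noteq> 2 \<and> q \<noteq> 3 \<and> q \<noteq> 7"
          using less.prems(3) [OF \<open>prime q\<close>] dvd_mult [of q "k * m" p] by (simp add: k mult.assoc)
        show "q dvd m \<Longrightarrow> \<exists>c. [c ^ 3 = 28] (mod int q)"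
          using less.prems(4) [OF \<open>prime q\<close>] by simp
      qed
      then show ?thesis
        unfolding v using coherent_jacobi_cube p_ne coherent_mult by blast
    qed
  qed
qed

section \<open>The equation\<close>

lemma cube_root_28:
  fixes p :: nat and x t :: int
  assumes p: "prime p" "\<not> int p dvd x" and dvd: "int p dvd 28 * x ^ 3 + t ^ 3"
  shows "\<exists>c. [c ^ 3 = 28] (mod int p)"
proof -
  have "coprime x (int p)"
    using p by (metis coprime_commute prime_imp_coprime prime_nat_int_transfer)
  then obtain y where "[x * y = 1] (mod int p)"
    using cong_solve_coprime_int by blast
  then have y: "[(x * y) ^ 3 = 1 ^ 3] (mod int p)"
    by (rule cong_pow)
  have "(- t * y) ^ 3 - 28 = 28 * ((x * y) ^ 3 - 1) - (28 * x ^ 3 + t ^ 3) * y ^ 3"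
    by (simp add: power_mult_distrib algebra_simps)
  also have "int p dvd \<dots>"
    by (rule dvd_diff [OF dvd_mult dvd_mult2 [OF dvd]]) (use y in \<open>simp add: cong_iff_dvd_diff\<close>)
  finally have "int p dvd (- t * y) ^ 3 - 28" .
  then show ?thesis
    unfolding cong_iff_dvd_diff ..
qed

lemma mod_7_cases:
  "(x :: int) mod 7 = 0 \<or> x mod 7 = 1 \<or> x mod 7 = 2 \<or> x mod 7 = 3 \<or> x mod 7 = 4
    \<or> x mod 7 = 5 \<or> x mod 7 = 6"
  by presburger

lemma cube_mod_7: "(x :: int) ^ 3 mod 7 \<in> {0, 1, 6}"
proof -
  have "x ^ 3 mod 7 = (x mod 7) ^ 3 mod 7"
    by (rule power_mod [symmetric])
  then show ?thesis
    using mod_7_cases [of x] by (elim disjE) simp_all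
qed

lemma sixth_power_mod_7: "\<not> 7 dvd (x :: int) \<Longrightarrow> (x ^ 3) ^ 2 mod 7 = 1"
proof -
  assume "\<not> 7 dvd x"
  then have "x ^ 3 mod 7 \<noteq> 0"
    using prime_dvd_power [of "7 :: int" x 3] by auto
  then have "x ^ 3 mod 7 = 1 \<or> x ^ 3 mod 7 = 6"
    using cube_mod_7 [of x] by auto
  moreover have "(x ^ 3) ^ 2 mod 7 = (x ^ 3 mod 7) ^ 2 mod 7"
    by (rule power_mod [symmetric])
  ultimately show ?thesis by (elim disjE) simp_all
qed

lemma square_mod_7:
  fixes x :: int
  shows "x ^ 2 mod 7 \<in> {0, 1, 2, 4}"
    and "x ^ 2 mod 7 = 2 \<Longrightarrow> x mod 7 = 3 \<or> x mod 7 = 4"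
proof -
  have *: "x ^ 2 mod 7 = (x mod 7) ^ 2 mod 7"
    by (rule power_mod [symmetric])
  show "x ^ 2 mod 7 \<in> {0, 1, 2, 4}"
    using mod_7_cases [of x] * by (elim disjE) simp_all
  show "x ^ 2 mod 7 = 2 \<Longrightarrow> x mod 7 = 3 \<or> x mod 7 = 4"
    using mod_7_cases [of x] * by (elim disjE) simp_all
qed

lemma solution_mod_7:
  fixes x y z :: int
  assumes "7 * x ^ 3 + 2 * y ^ 3 = 3 * z ^ 2 + 1"
  shows "7 dvd y" "z mod 7 = 3 \<or> z mod 7 = 4"
proof -
  have "[3 * (z ^ 2 mod 7) + 1 = 3 * z ^ 2 + 1] (mod 7)"
    by (intro cong_add cong_mult cong_refl) (simp add: cong_def)
  also have "3 * z ^ 2 + 1 = 2 * y ^ 3 + 7 * x ^ 3"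
    using assms by simp
  also have "[2 * y ^ 3 + 7 * x ^ 3 = 2 * y ^ 3] (mod 7)"
    unfolding cong_def by (rule mod_mult_self2)
  also have "[2 * y ^ 3 = 2 * (y ^ 3 mod 7)] (mod 7)"
    by (intro cong_mult cong_refl) (simp add: cong_def)
  finally have "(3 * (z ^ 2 mod 7) + 1) mod 7 = (2 * (y ^ 3 mod 7)) mod 7"
    unfolding cong_def .
  then have "z ^ 2 mod 7 = 2" "y ^ 3 mod 7 = 0"
    using cube_mod_7 [of y] square_mod_7(1) [of z] by auto
  then show "z mod 7 = 3 \<or> z mod 7 = 4" "7 dvd y"
    using square_mod_7(2) [of z] prime_dvd_power [of "7 :: int" y 3] by auto
qed

text \<open>If \<open>z\<close> were odd, \<open>3 z\<^sup>2 + 1\<close> would be 4 modulo 8; then \<open>x\<close> would be even and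
  \<open>2 y\<^sup>3\<close> would be 4 modulo 8, which is impossible for a cube.\<close>

lemma solution_even:
  fixes x y z :: int
  assumes eq: "7 * x ^ 3 + 2 * y ^ 3 = 3 * z ^ 2 + 1"
  shows "even z"
proof (rule ccontr)
  assume "odd z"
  then obtain k where k: "z = 2 * k + 1"
    by (auto elim: oddE)
  have "even (7 * x ^ 3)"
  proof -
    have "7 * x ^ 3 = 2 * (6 * k * k + 6 * k + 2 - y ^ 3)"
      using eq by (simp add: k power2_eq_square algebra_simps)
    then show ?thesis by simp
  qed
  then obtain a where a: "x = 2 * a"
    by (auto elim: evenE)
  have y: "28 * a ^ 3 + y ^ 3 = 6 * (k * (k + 1)) + 2"
    using eq by (simp add: k a power2_eq_square power_mult_distrib algebra_simps)
  have "even (y ^ 3)"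
  proof -
    have "y ^ 3 = 2 * (3 * (k * (k + 1)) + 1 - 14 * a ^ 3)"
      using y by simp
    then show ?thesis by simp
  qed
  then obtain b where b: "y = 2 * b"
    by (auto elim: evenE)
  have "14 * a ^ 3 + 4 * b ^ 3 = 3 * (k * (k + 1)) + 1"
    using y by (simp add: b power_mult_distrib)
  moreover have "even (k * (k + 1))" by simp
  then obtain j where "k * (k + 1) = 2 * j" ..
  ultimately have "1 = 2 * (7 * a ^ 3 + 2 * b ^ 3 - 3 * j)"
    by simp
  then show False
    by (metis dvd_triv_left odd_one)
qed

text \<open>Let \<open>\<alpha> = 1 + z \<surd>-3\<close>, whose norm is \<open>3 z\<^sup>2 + 1\<close>, and let \<open>u\<close> be its part prime to 7. Since \<open>z\<close>
  is even, \<open>u\<close> is 1 modulo 2, so coherence makes \<open>N\<^sup>2\<close> times the square of \<open>u\<close> equal to 1 modulo each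
  prime above 7. At the prime that does not divide \<open>\<alpha>\<close>, the residue of \<open>u\<close> is determined by \<open>z\<close> and
  \<open>a\<close>, and it violates this in both cases.\<close>

lemma no_norm_factorization:
  fixes z :: int and a g m :: nat
  defines "N \<equiv> int (g ^ 3 * m)"
  assumes z: "even z" "z mod 7 = 4" and norm: "3 * z ^ 2 + 1 = 7 ^ a * N"
    and cubes: "\<And>p. prime p \<Longrightarrow> p \<noteq> 2 \<Longrightarrow> p \<noteq> 7 \<Longrightarrow> p dvd m \<Longrightarrow> \<exists>c. [c ^ 3 = 28] (mod int p)"
    and a: "4 ^ a mod 7 = (4 :: int) \<and> N ^ 2 mod 7 = 1 \<or> 4 ^ a mod 7 = (1 :: int) \<and> N ^ 2 mod 7 = 4"
  shows False
proof -
  define \<alpha> where "\<alpha> = Eis (1 + z) (2 * z)"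
  define \<pi> where "\<pi> = Eis 3 2"
  have norm_\<alpha>: "eis_norm \<alpha> = 7 ^ a * N"
  proof -
    have "eis_norm \<alpha> = 3 * z ^ 2 + 1"
      by (simp add: \<alpha>_def eis_norm_def power2_eq_square algebra_simps)
    then show ?thesis
      by (simp only: norm)
  qed
  have norm_\<pi>: "eis_norm \<pi> = 7"
    by (simp add: \<pi>_def eis_norm_def)
  have prim: "primitive \<alpha>"
  proof -
    obtain t where t: "z = 2 * t"
      using z(1) by (auto elim: evenE)
    have "coprime (1 + z) (2 * z)"
    proof (rule coprimeI)
      fix d assume d: "d dvd 1 + z" "d dvd 2 * z"
      have "1 = (1 + z) * (1 - 2 * t) + 2 * z * t"
        by (simp add: t algebra_simps)
      then show "d dvd 1"
        using d by (metis dvd_add dvd_mult2)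
    qed
    then show ?thesis
      by (simp add: primitive_def \<alpha>_def)
  qed
  \<comment> \<open>The prime \<open>\<pi> = 2 + \<surd>-3\<close> above 7 is the kernel of evaluation at 2, its conjugate that of
    evaluation at 4.\<close>
  have \<alpha>_2: "[eis_eval 2 \<alpha> = 0] (mod 7)"
    unfolding \<alpha>_def eis_eval_def cong_def eis.sel using z(2) by presburger
  have \<pi>_2: "[eis_eval 2 \<pi> = 0] (mod 7)"
    by (simp add: \<pi>_def eis_eval_def cong_def)
  have root_2: "[2\<^sup>2 + 2 + 1 = 0] (mod (7 :: int))"
    by (simp add: cong_def)
  have "\<pi> ^ a dvd \<alpha>"
    using primitive_eval_zero_power_dvd [OF _ root_2 norm_\<pi> \<pi>_2 prim \<alpha>_2, of a]
    by (simp add: norm_\<alpha>)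
  then obtain u where u: "\<alpha> = \<pi> ^ a * u" ..
  have norm_u: "eis_norm u = N"
    using norm_\<alpha> by (simp add: u norm_mult norm_power norm_\<pi>)
  have odd: "odd (3 * z ^ 2 + 1)"
    using z by simp
  have pos: "g * m > 0"
  proof (rule ccontr)
    assume "\<not> g * m > 0"
    then have "N = 0"
      by (auto simp: N_def)
    then show False
      using norm zero_le_power2 [of z] by simp
  qed
  have "coherent u"
  proof (rule coherent_of_norm)
    show "primitive u"
      using prim u primitive_mult_right by simp
    show "eis_norm u = int (g ^ 3 * m)"
      using norm_u by (simp add: N_def)
    show "g * m > 0" by (rule pos)
    show ne: "p \<noteq> 2 \<and> p \<noteq> 3 \<and> p \<noteq> 7" if "prime p" "p dvd g * m" for p
    proof -
      have "p dvd g ^ 3 * m"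
        using that by (auto simp: prime_dvd_mult_iff eval_nat_numeral)
      then have dN: "int p dvd N"
        by (simp only: N_def int_dvd_int_iff)
      then have dz: "int p dvd 3 * z ^ 2 + 1"
        by (simp add: norm)
      have "\<not> 7 dvd N"
        using a by (auto simp: power2_eq_square)
      then show ?thesis
        using dz dN odd by (auto simp: dvd_add_right_iff)
    qed
    show "\<exists>c. [c ^ 3 = 28] (mod int p)" if "prime p" "p dvd m" for p
      using cubes [OF that(1)] that ne [of p] by auto
  qed
  then obtain c where c: "c ^ 3 = 1" "2 dvd u - c" "7 dvd u ^ 4 * eis_cnj u ^ 2 - c ^ 2"
    by (auto simp: coherent_def)
  have two: "2 dvd \<pi> - 1" "2 dvd \<alpha> - 1"
    using z of_int_dvd_iff_eis [of 2 "\<pi> - 1"] of_int_dvd_iff_eis [of 2 "\<alpha> - 1"]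
    by (simp_all add: \<pi>_def \<alpha>_def one_eis_def)
  have \<pi>_power: "2 dvd \<pi> ^ n - 1" for n
  proof (induction n)
    case (Suc n)
    then show ?case
      using dvd_mult_diff [OF two(1), of "\<pi> ^ n" 1] by simp
  qed simp
  have "(\<alpha> - 1) - (\<pi> ^ a - 1) * u = u - 1"
    by (simp add: u algebra_simps)
  then have "2 dvd u - 1"
    using dvd_diff [OF two(2) dvd_mult2 [OF \<pi>_power], of a u] by (simp only:)
  from dvd_diff [OF this c(2)] have c2: "2 dvd c - 1"
    by simp
  have "c = 1"
  proof (rule ccontr)
    assume "c \<noteq> 1"
    moreover have "(c - 1) * (c * c + c + 1) = c ^ 3 - 1"
      by (simp add: eval_nat_numeral algebra_simps)
    ultimately have "c * c + c + 1 = 0"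
      using c(1) by simp
    moreover have "2 dvd (c * c - 1 * 1) + (c - 1)"
      by (intro dvd_add dvd_mult_diff c2)
    moreover have "(c * c - 1 * 1) + (c - 1) = (c * c + c + 1) - 3"
      by (simp add: algebra_simps)
    ultimately have "(2 :: eis) dvd 0 - 3"
      by (simp only:)
    then have "(2 :: eis) dvd 3"
      using dvd_minus_iff [of 2 "3 :: eis"] by simp
    then show False
      using of_int_dvd_iff_eis [of 2 3] by (simp add: eis_numeral)
  qed
  define e where "e = eis_eval 4 u"
  define f where "f = eis_eval 4 (eis_cnj u)"
  have root: "[4\<^sup>2 + 4 + 1 = 0] (mod (7 :: int))"
    by (simp add: cong_def)
  have ef: "[e * f = N] (mod 7)"
    unfolding e_def f_def norm_u [symmetric] by (rule cong_sym [OF eval_eq_cnj_eval [OF root]])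
  have "7 dvd eis_eval 4 (u ^ 4 * eis_cnj u ^ 2 - 1)"
    using c(3) \<open>c = 1\<close> of_int_dvd_eval [of 7 "u ^ 4 * eis_cnj u ^ 2 - 1"] by simp
  then have "[eis_eval 4 (u ^ 4 * eis_cnj u ^ 2) = 1] (mod 7)"
    by (simp add: eval_diff cong_iff_dvd_diff)
  moreover have "[eis_eval 4 (u ^ 4 * eis_cnj u ^ 2) = e ^ 4 * f ^ 2] (mod 7)"
    unfolding e_def f_def
    by (rule cong_trans [OF eval_mult [OF root]]) (intro cong_mult eval_power [OF root])
  ultimately have "[e ^ 4 * f ^ 2 = 1] (mod 7)"
    by (simp only: cong_def)
  moreover have "e ^ 4 * f ^ 2 = (e * f) ^ 2 * e ^ 2"
    by (simp add: eval_nat_numeral mult_ac)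
  moreover have "[(e * f) ^ 2 * e ^ 2 = N ^ 2 * e ^ 2] (mod 7)"
    by (intro cong_mult cong_pow cong_refl ef)
  ultimately have "[N ^ 2 * e ^ 2 = 1] (mod 7)"
    by (simp only: cong_def)
  moreover have "[(N ^ 2 mod 7) * (e mod 7) ^ 2 = N ^ 2 * e ^ 2] (mod 7)"
    by (intro cong_mult cong_pow) (simp_all add: cong_def)
  ultimately have "(N ^ 2 mod 7) * (e mod 7) ^ 2 mod 7 = 1"
    by (simp add: cong_def)
  moreover have "[4 ^ a * e = 2] (mod 7)"
  proof -
    have "[eis_eval 4 \<alpha> = eis_eval 4 (\<pi> ^ a) * e] (mod 7)"
      unfolding u e_def by (rule eval_mult [OF root])
    also have "[eis_eval 4 (\<pi> ^ a) * e = eis_eval 4 \<pi> ^ a * e] (mod 7)"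
      by (intro cong_mult eval_power [OF root] cong_refl)
    also have "[eis_eval 4 \<pi> ^ a * e = 4 ^ a * e] (mod 7)"
      by (intro cong_mult cong_pow cong_refl) (simp add: \<pi>_def eis_eval_def cong_def)
    finally have "[eis_eval 4 \<alpha> = 4 ^ a * e] (mod 7)" .
    moreover have "[eis_eval 4 \<alpha> = 2] (mod 7)"
      unfolding \<alpha>_def eis_eval_def cong_def eis.sel using z(2) by presburger
    ultimately show ?thesis
      by (simp only: cong_def)
  qed
  then have "(4 ^ a mod 7) * (e mod 7) mod 7 = 2"
    by (simp add: cong_def mod_mult_eq)
  ultimately show False
    using a mod_7_cases [of e] by (elim disjE conjE) simp_all
qed

theorem theorem3p1:
  shows "\<not> (\<exists>x y z :: int. 7 * x ^ 3 + 2 * y ^ 3 = 3 * z ^ 2 + 1)"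
proof
  assume "\<exists>x y z :: int. 7 * x ^ 3 + 2 * y ^ 3 = 3 * z ^ 2 + 1"
  then obtain x y z :: int where eq0: "7 * x ^ 3 + 2 * y ^ 3 = 3 * z ^ 2 + 1"
    by blast
  have "\<exists>z'. (z' = z \<or> z' = - z) \<and> z' mod 7 = 4"
  proof (cases "z mod 7 = 4")
    case False
    then have "- z mod 7 = 4"
      using solution_mod_7(2) [OF eq0] by presburger
    then show ?thesis by blast
  qed blast
  then obtain z' where z': "z' = z \<or> z' = - z" "z' mod 7 = 4"
    by blast
  then have eq: "7 * x ^ 3 + 2 * y ^ 3 = 3 * z' ^ 2 + 1"
    using eq0 by auto
  obtain v where v: "y = 7 * v"
    using solution_mod_7(1) [OF eq] ..
  have main: "3 * z' ^ 2 + 1 = 7 * (x ^ 3 + 98 * v ^ 3)"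
    using eq by (simp add: v power_mult_distrib)
  define D where "D = gcd x v"
  have "D \<noteq> 0"
  proof
    assume "D = 0"
    then have "7 * (x ^ 3 + 98 * v ^ 3) = 0" by (simp add: D_def)
    then show False using main zero_le_power2 [of z'] by linarith
  qed
  obtain X V where XV: "x = D * X" "v = D * V" "coprime X V"
    using gcd_coprime_exists [of x v] \<open>D \<noteq> 0\<close> unfolding D_def by (metis mult.commute)
  obtain k h where h: "D = 7 ^ k * h" "\<not> 7 dvd h"
    using multiplicity_decompose' [of D 7 thesis] \<open>D \<noteq> 0\<close> by auto
  have D0: "D > 0" using \<open>D \<noteq> 0\<close> by (simp add: D_def)
  then have h0: "h > 0"
    using h(1) by (simp add: zero_less_mult_iff)
  define M where "M = X ^ 3 + 98 * V ^ 3"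
  have norm: "3 * z' ^ 2 + 1 = 7 ^ (3 * k + 1) * (h ^ 3 * M)"
  proof -
    have "x ^ 3 + 98 * v ^ 3 = D ^ 3 * M"
      by (simp add: XV M_def power_mult_distrib algebra_simps)
    also have "D ^ 3 = 7 ^ (3 * k) * h ^ 3"
      by (simp add: h(1) power_mult_distrib mult.commute flip: power_mult)
    finally show ?thesis
      using main by simp
  qed
  have h6: "(h ^ 3) ^ 2 mod 7 = 1"
    using h(2) by (rule sixth_power_mod_7)
  have h_mod: "(h ^ 3 * n) ^ 2 mod 7 = n ^ 2 mod 7" for n
  proof -
    have "(h ^ 3 * n) ^ 2 mod 7 = ((h ^ 3) ^ 2 mod 7 * n ^ 2) mod 7"
      by (simp only: power_mult_distrib mod_mult_left_eq)
    then show ?thesis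
      by (simp only: h6 mult_1)
  qed
  have four: "4 ^ (3 * k + n) mod 7 = (4 ^ n mod 7 :: int)" for n
  proof -
    have "[(4 ^ 3) ^ k * 4 ^ n = 1 ^ k * 4 ^ n] (mod (7 :: int))"
      by (intro cong_mult cong_pow cong_refl) (simp add: cong_def)
    then show ?thesis
      by (simp add: cong_def power_add power_mult)
  qed
  \<comment> \<open>Coprimality keeps the prime factors of the two cubic forms below from dividing the variable
    whose cube has to be inverted.\<close>
  have p_cop: "\<not> (int p dvd X \<and> int p dvd V)" if "prime p" for p :: nat
    using XV(3) that by (meson coprime_common_divisor not_prime_unit prime_nat_int_transfer)
  have p_V: "int p dvd V" if "prime p" "p \<noteq> 2" "p \<noteq> 7" "int p dvd c * V ^ 3" "c = 2 \<or> c = 98"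
    for p :: nat and c
  proof -
    have pp: "prime (int p)" using that by simp
    have nd: "\<not> int p dvd 2" "\<not> int p dvd 7"
      using that prime_not_dvd_prime [of p 2] prime_not_dvd_prime [of p 7] by simp_all
    then have "\<not> int p dvd 2 * (7 * 7)"
      using pp by (simp only: prime_dvd_mult_iff) blast
    then have "\<not> int p dvd c"
      using that(5) nd by auto
    then have "int p dvd V ^ 3"
      using pp that(4) prime_dvd_mult_iff by blast
    then show ?thesis
      using pp prime_dvd_power by blast
  qed
  have "3 * z' ^ 2 + 1 > 0"
    using zero_le_power2 [of z'] by linarith
  then have M0: "M > 0"
    using norm h0 by (simp add: zero_less_mult_iff)
  \<comment> \<open>The exponent of 7 in the norm is \<open>3 k + 1\<close> or \<open>3 k + 3\<close>, according to which of the two terms of \<open>M\<close> has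
    the lower 7-adic valuation.\<close>
  show False
  proof (cases "7 dvd X")
    case False
    have nat: "int (nat h ^ 3 * nat M) = h ^ 3 * M"
      using h0 M0 by simp
    show False
    proof (rule no_norm_factorization [OF solution_even [OF eq] z'(2), of "3 * k + 1" "nat h" "nat M"])
      show "3 * z' ^ 2 + 1 = 7 ^ (3 * k + 1) * int (nat h ^ 3 * nat M)"
        unfolding nat by (rule norm)
      have "M mod 7 = X ^ 3 mod 7"
        using mod_mult_self2 [of "X ^ 3" 7 "14 * V ^ 3"] by (simp add: M_def)
      then have "M ^ 2 mod 7 = (X ^ 3) ^ 2 mod 7"
        using cong_pow [of M "X ^ 3" 7 2] by (simp only: cong_def)
      then have "(h ^ 3 * M) ^ 2 mod 7 = 1"
        by (simp only: h_mod sixth_power_mod_7 [OF False])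
      moreover have "4 ^ (3 * k + 1) mod 7 = (4 :: int)"
        by (simp only: four) simp
      ultimately show "4 ^ (3 * k + 1) mod 7 = (4 :: int) \<and> int (nat h ^ 3 * nat M) ^ 2 mod 7 = 1 \<or>
        4 ^ (3 * k + 1) mod 7 = (1 :: int) \<and> int (nat h ^ 3 * nat M) ^ 2 mod 7 = 4"
        unfolding nat by simp
      fix p :: nat
      assume p: "prime p" "p \<noteq> 2" "p \<noteq> 7" "p dvd nat M"
      then have pM: "int p dvd M"
        using M0 int_dvd_int_iff [of p "nat M"] by simp
      show "\<exists>c. [c ^ 3 = 28] (mod int p)"
      proof (rule cube_root_28 [OF p(1)])
        show "\<not> int p dvd X"
        proof
          assume X: "int p dvd X"
          then have "int p dvd M - X * X\<^sup>2"
            using pM by (intro dvd_diff) simp_all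
          also have "M - X * X\<^sup>2 = 98 * V ^ 3"
            by (simp add: M_def eval_nat_numeral)
          finally show False
            using p_V [OF p(1-3)] X p_cop [OF p(1)] by blast
        qed
        have "28 * X ^ 3 + (14 * V) ^ 3 = 28 * M"
          by (simp add: M_def power_mult_distrib)
        then show "int p dvd 28 * X ^ 3 + (14 * V) ^ 3"
          using pM by simp
      qed
    qed
  next
    case True
    then obtain W where W: "X = 7 * W" ..
    define L where "L = 7 * W ^ 3 + 2 * V ^ 3"
    have M_eq: "M = 49 * L"
      by (simp add: M_def L_def W power_mult_distrib)
    then have L0: "L > 0"
      using M0 by simp
    have nat: "int (nat h ^ 3 * nat L) = h ^ 3 * L"
      using h0 L0 by simp
    have "\<not> 7 dvd V"
      using True p_cop [of 7] by simp
    show False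
    proof (rule no_norm_factorization [OF solution_even [OF eq] z'(2), of "3 * k + 3" "nat h" "nat L"])
      show "3 * z' ^ 2 + 1 = 7 ^ (3 * k + 3) * int (nat h ^ 3 * nat L)"
        unfolding nat norm by (simp add: M_eq power_add)
      have "L mod 7 = (2 * V ^ 3) mod 7"
        using mod_mult_self2 [of "2 * V ^ 3" 7 "W ^ 3"] by (simp add: L_def add.commute)
      then have "L ^ 2 mod 7 = (2 * V ^ 3) ^ 2 mod 7"
        using cong_pow [of L "2 * V ^ 3" 7 2] by (simp only: cong_def)
      also have "\<dots> = (4 * ((V ^ 3) ^ 2 mod 7)) mod 7"
        by (simp add: power_mult_distrib mod_mult_right_eq)
      also have "\<dots> = 4"
        by (simp only: sixth_power_mod_7 [OF \<open>\<not> 7 dvd V\<close>]) simp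
      finally have "(h ^ 3 * L) ^ 2 mod 7 = 4"
        by (simp only: h_mod)
      moreover have "4 ^ (3 * k + 3) mod 7 = (1 :: int)"
        by (simp only: four) simp
      ultimately show "4 ^ (3 * k + 3) mod 7 = (4 :: int) \<and> int (nat h ^ 3 * nat L) ^ 2 mod 7 = 1 \<or>
        4 ^ (3 * k + 3) mod 7 = (1 :: int) \<and> int (nat h ^ 3 * nat L) ^ 2 mod 7 = 4"
        unfolding nat by simp
      fix p :: nat
      assume p: "prime p" "p \<noteq> 2" "p \<noteq> 7" "p dvd nat L"
      then have pL: "int p dvd L"
        using L0 int_dvd_int_iff [of p "nat L"] by simp
      show "\<exists>c. [c ^ 3 = 28] (mod int p)"
      proof (rule cube_root_28 [OF p(1)])
        show "\<not> int p dvd W"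
        proof
          assume Wp: "int p dvd W"
          then have "int p dvd L - W * (7 * W\<^sup>2)"
            using pL by (intro dvd_diff) simp_all
          also have "L - W * (7 * W\<^sup>2) = 2 * V ^ 3"
            by (simp add: L_def eval_nat_numeral)
          finally show False
            using p_V [OF p(1-3)] Wp p_cop [OF p(1)] W by auto
        qed
        have "28 * W ^ 3 + (2 * V) ^ 3 = 4 * L"
          by (simp add: L_def power_mult_distrib)
        then show "int p dvd 28 * W ^ 3 + (2 * V) ^ 3"
          using pL by simp
      qed
    qed
  qed
qed

end
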